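(* For each pair partition $\mathfrak{m}\in\mathcal{P}_k$, with $t=1-\frac NM$, the Weingarten function has the large $N$ expansion (with $M/N=1/(1-t)$ held fixed) \[ \mathrm{Wg}^{\mathbf{A}}(\mathfrak{m})=\frac1{(1-t)^k}\sum_{r=0}^\infty \vec h^{(t)}_r(\mathfrak{m})\Big(-\frac1N\Big)^r. \]
   Context: $\mathbf{A}(M,N)$ ($M<N$) is the space of $N\times N$ real symmetric idempotent matrices of rank $M$ with its $\mathrm{O}(N)$-invariant Haar probability measure $\mathrm{d}\mu$; $A_{ij}$ is the $(i,j)$ entry. $\mathcal{P}_k$ is the set of pair partitions of $\{1,\ldots,2k\}$; $\mathfrak{e}_k=\{\{1,2\},\{3,4\},\ldots,\{2k-1,2k\}\}$. $S_{2k}$ acts on $\mathcal{P}_k$ by $\{a,b\}\in\mathfrak{m}\iff\{\sigma(a),\sigma(b)\}\in\sigma\cdot\mathfrak{m}$. $\mathrm{Wg}^{\mathbf{A}}(\mathfrak{m})=\int_{\mathbf{A}(M,N)}A_{i(1)i(2)}\cdots A_{i(2k-1)i(2k)}\,\mathrm{d}\mu$, where $i:\{1,\ldots,2k\}\to\{1,\ldots,N\}$ satisfies $i(a)=i(b)\iff\{a,b\}\in\mathfrak{m}$ for $a\ne b$. A monotone factorisation of $\mathfrak{m}\in\mathcal{P}_k$ is a sequence $\boldsymbol\tau=(\tau_1,\ldots,\tau_r)$ of transpositions $\tau_s=(a_s~b_s)\in S_{2k}$, $a_s<b_s$, with $b_1\le b_2\le\cdots\le b_r$ all odd and $\tau_1\circ\cdots\circ\tau_r\cdot\mathfrak{m}=\mathfrak{e}_k$;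 its length is $r$ and its hive number $\mathrm{hive}(\boldsymbol\tau)$ is the number of distinct values among $b_1,\ldots,b_r$. $\vec h^{(t)}_r(\mathfrak{m})\in\mathbb{Z}[t]$ is the sum of $t^{\mathrm{hive}(\boldsymbol\tau)}$ over monotone factorisations $\boldsymbol\tau$ of $\mathfrak{m}$ of length $r$. *)

theory Defs
  imports "HOL-Probability.Probability" "HOL-Library.Landau_Symbols"
    "HOL-Computational_Algebra.Polynomial" "HOL-Combinatorics.Transposition"
    "Jordan_Normal_Form.DL_Rank"
begin

text \<open>N x N real matrices are represented as functions on index pairs,
  extensional on {..<N} x {..<N} (0-based indices).\<close>
type_synonym rmat = "nat \<times> nat \<Rightarrow> real"

definition mat_space :: "nat \<Rightarrow> rmat measure" where
  "mat_space N = PiM ({..<N} \<times> {..<N}) (\<lambda>_. borel)"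

definition mmul :: "nat \<Rightarrow> rmat \<Rightarrow> rmat \<Rightarrow> rmat" where
  "mmul N A B = restrict (\<lambda>(i,j). \<Sum>l<N. A (i,l) * B (l,j)) ({..<N} \<times> {..<N})"

definition mtrans :: "nat \<Rightarrow> rmat \<Rightarrow> rmat" where
  "mtrans N A = restrict (\<lambda>(i,j). A (j,i)) ({..<N} \<times> {..<N})"

definition mid :: "nat \<Rightarrow> rmat" where
  "mid N = restrict (\<lambda>(i,j). if i = j then 1 else 0) ({..<N} \<times> {..<N})"

definition orthogonal_mat :: "nat \<Rightarrow> rmat \<Rightarrow> bool" where
  "orthogonal_mat N Q \<longleftrightarrow> Q \<in> space (mat_space N) \<and> mmul N Q (mtrans N Q) = mid N"

definition mrank :: "nat \<Rightarrow> rmat \<Rightarrow> nat" where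
  "mrank N A = vec_space.rank N (mat N N (\<lambda>(i,j). A (i,j)))"

definition Aspace :: "nat \<Rightarrow> nat \<Rightarrow> rmat set" where
  "Aspace M N = {A \<in> space (mat_space N). mtrans N A = A \<and> mmul N A A = A \<and> mrank N A = M}"

text \<open>mu is an O(N)-invariant probability measure on A(M,N)
  (a probability measure on N x N matrices, concentrated on A(M,N), invariant
   under conjugation A \<mapsto> O A O^T for every orthogonal O). Such a measure is unique.\<close>
definition haar_A :: "nat \<Rightarrow> nat \<Rightarrow> rmat measure \<Rightarrow> bool" where
  "haar_A M N \<mu> \<longleftrightarrow> prob_space \<mu> \<and> sets \<mu> = sets (mat_space N)
     \<and> (AE A in \<mu>. A \<in> Aspace M N)
     \<and> (\<forall>Q. orthogonal_mat N Q \<longrightarrow>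
            distr \<mu> (mat_space N) (\<lambda>A. mmul N (mmul N Q A) (mtrans N Q)) = \<mu>)"

definition pair_partitions :: "nat \<Rightarrow> nat set set set" where
  "pair_partitions k = {m. (\<forall>p\<in>m. card p = 2) \<and> \<Union>m = {1..2*k}
      \<and> (\<forall>p\<in>m. \<forall>p'\<in>m. p \<noteq> p' \<longrightarrow> p \<inter> p' = {})}"

definition e_part :: "nat \<Rightarrow> nat set set" where
  "e_part k = (\<lambda>s. {2 * s + 1, 2 * s + 2}) ` {..<k}"

definition perm_act :: "(nat \<Rightarrow> nat) \<Rightarrow> nat set set \<Rightarrow> nat set set" where
  "perm_act \<sigma> m = (\<lambda>p. \<sigma> ` p) ` m"

definition index_fun :: "nat \<Rightarrow> nat \<Rightarrow> nat set set \<Rightarrow> (nat \<Rightarrow> nat)" where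
  "index_fun N k m = (SOME i. (\<forall>a\<in>{1..2*k}. i a < N) \<and>
      (\<forall>a\<in>{1..2*k}. \<forall>b\<in>{1..2*k}. a \<noteq> b \<longrightarrow> (i a = i b \<longleftrightarrow> {a,b} \<in> m)))"

definition WgA :: "rmat measure \<Rightarrow> nat \<Rightarrow> nat \<Rightarrow> nat set set \<Rightarrow> real" where
  "WgA \<mu> N k m = (let i = index_fun N k m in
      \<integral>A. (\<Prod>s<k. A (i (2 * s + 1), i (2 * s + 2))) \<partial>\<mu>)"

definition monotone_facts :: "nat \<Rightarrow> nat set set \<Rightarrow> nat \<Rightarrow> (nat \<times> nat) list set" where
  "monotone_facts k m r = {ts. length ts = r
      \<and> (\<forall>(a,b)\<in>set ts. 1 \<le> a \<and> a < b \<and> b \<le> 2*k \<and> odd b)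
      \<and> sorted (map snd ts)
      \<and> perm_act (foldr (\<lambda>(a,b) f. Transposition.transpose a b \<circ> f) ts id) m = e_part k}"

definition hive :: "(nat \<times> nat) list \<Rightarrow> nat" where
  "hive ts = card (set (map snd ts))"

definition hvec :: "nat \<Rightarrow> nat set set \<Rightarrow> nat \<Rightarrow> int poly" where
  "hvec k m r = (\<Sum>ts\<in>monotone_facts k m r. monom 1 (hive ts))"

end

theory Submission
  imports Defs
begin

text \<open>
  Write \<open>W k m\<close> for the Weingarten function and \<open>\<tau>\<^sub>a\<close> for the transposition \<open>(a, 2k+1)\<close>.
  Let \<open>W\<^sub>0 m\<close> be \<open>W k (m - {{2k+1, 2k+2}})\<close> if \<open>{2k+1, 2k+2} \<in> m\<close>, and \<open>0\<close> otherwise. Setting the index of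
  the block of \<open>2k+1\<close> to \<open>j\<close> and summing over all \<open>j < N\<close> gives, by \<open>A\<^sup>2 = A\<close> or \<open>tr A = M\<close>,
  \[ N W(k+1,m) + \sum_{a=1}^{2k} W(k+1,\tau_a m) = M W_0(m) + \sum_{a=1}^{2k} W_0(\tau_a m). \]
  The terms with \<open>\<tau>\<^sub>a\<close> come from the values \<open>j\<close> that collide with another block: a moment with four equal
  indices is the sum of the three moments over the pairings of these positions, which follows from
  invariance under the rotation by 45 degrees in a coordinate plane. Removing the last
  transposition from a monotone factorisation yields the same recursion for the truncated
  expansions, and moments are bounded by 1, so the error gains a factor \<open>1/N\<close> with each order.
\<close>

section \<open>Pair partitions\<close>

abbreviation odd_swap :: "nat \<Rightarrow> nat \<Rightarrow> nat set set \<Rightarrow> nat set set" where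
  "odd_swap k a \<equiv> perm_act (Transposition.transpose a (2*k+1))"

abbreviation last_pair :: "nat \<Rightarrow> nat set" where
  "last_pair k \<equiv> {2*k+1, 2*k+2}"

lemma perm_act_compose: "perm_act (f \<circ> g) m = perm_act f (perm_act g m)"
  by (simp add: perm_act_def image_comp o_def)

text \<open>A transposition is its own inverse, so blocks of the image are tested by pulling them
  back to \<open>m\<close>.\<close>

lemma pair_in_transpose_iff:
  "{x,y} \<in> perm_act (Transposition.transpose a b) m \<longleftrightarrow>
   {Transposition.transpose a b x, Transposition.transpose a b y} \<in> m"
proof
  assume "{x,y} \<in> perm_act (Transposition.transpose a b) m"
  then obtain p where p: "p \<in> m" "{x,y} = Transposition.transpose a b ` p" by (auto simp: perm_act_def)
  then have "Transposition.transpose a b ` {x,y} = p" by (simp add: image_image del: image_insert)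
  with p(1) show "{Transposition.transpose a b x, Transposition.transpose a b y} \<in> m" by simp
next
  assume *: "{Transposition.transpose a b x, Transposition.transpose a b y} \<in> m"
  have "{x,y} = Transposition.transpose a b ` {Transposition.transpose a b x, Transposition.transpose a b y}"
    by simp
  with * show "{x,y} \<in> perm_act (Transposition.transpose a b) m" unfolding perm_act_def by blast
qed

lemma transpose_pair_partition:
  assumes m: "m \<in> pair_partitions k" and a: "a \<in> {1..2*k}" and b: "b \<in> {1..2*k}"
  shows "perm_act (Transposition.transpose a b) m \<in> pair_partitions k"
proof -
  let ?t = "Transposition.transpose a b"
  have inj: "inj ?t" by (rule inj_transpose)
  have "\<Union> (perm_act ?t m) = ?t ` \<Union> m" by (auto simp: perm_act_def)
  also have "\<dots> = ?t ` {1..2*k}" using m by (simp add: pair_partitions_def)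
  also have "\<dots> = {1..2*k}" using a b by (simp add: transpose_image_eq)
  finally have "\<Union> (perm_act ?t m) = {1..2*k}" .
  moreover have "\<forall>q\<in>perm_act ?t m. card q = 2"
    using m inj by (auto simp: pair_partitions_def perm_act_def card_image inj_on_subset)
  moreover have "\<forall>q\<in>perm_act ?t m. \<forall>q'\<in>perm_act ?t m. q \<noteq> q' \<longrightarrow> q \<inter> q' = {}"
  proof -
    have "?t ` p \<inter> ?t ` p' = {}" if "p \<in> m" "p' \<in> m" "?t ` p \<noteq> ?t ` p'" for p p'
    proof -
      have "p \<inter> p' = {}" using m that unfolding pair_partitions_def by blast
      then show ?thesis using inj by (simp flip: image_Int)
    qed
    then show ?thesis unfolding perm_act_def by blast
  qed
  ultimately show ?thesis by (simp add: pair_partitions_def)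
qed

lemma pair_partition_disjoint:
  assumes "m \<in> pair_partitions k" "p \<in> m" "p' \<in> m" "x \<in> p" "x \<in> p'"
  shows "p = p'"
proof (rule ccontr)
  assume "p \<noteq> p'"
  moreover have "\<forall>p\<in>m. \<forall>p'\<in>m. p \<noteq> p' \<longrightarrow> p \<inter> p' = {}" using assms(1) by (simp add: pair_partitions_def)
  ultimately have "p \<inter> p' = {}" using assms(2,3) by simp
  then show False using assms(4,5) by blast
qed

lemma pair_partition_partner:
  assumes m: "m \<in> pair_partitions k" and x: "x \<in> {1..2*k}"
  obtains y where "y \<in> {1..2*k}" "y \<noteq> x" "{x,y} \<in> m" "\<And>z. {x,z} \<in> m \<longleftrightarrow> z = y"
proof -
  have "x \<in> \<Union> m" using m x by (simp add: pair_partitions_def)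
  then obtain p where p: "p \<in> m" "x \<in> p" by blast
  then obtain y where y: "p = {x,y}" "y \<noteq> x" using m unfolding pair_partitions_def mem_Collect_eq card_2_iff
    by (metis doubleton_eq_iff empty_iff insert_iff)
  have yI: "y \<in> {1..2*k}" using p(1) y(1) m unfolding pair_partitions_def by blast
  have "z = y" if "{x,z} \<in> m" for z
  proof -
    have "{x,z} = p" using pair_partition_disjoint[OF m that p(1) _ p(2)] by simp
    then show ?thesis using y by (auto simp: doubleton_eq_iff)
  qed
  then show ?thesis using that[OF yI y(2)] p(1) y(1) by blast
qed

lemma pair_partition_remove_last:
  assumes m: "m \<in> pair_partitions (Suc k)" and E: "last_pair k \<in> m"
  shows "m - {last_pair k} \<in> pair_partitions k"
proof -
  have disj: "p \<inter> last_pair k = {}" if "p \<in> m" "p \<noteq> last_pair k" for p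
    using pair_partition_disjoint[OF m that(1) E] that(2) by blast
  have "\<Union> m = {1..2 * Suc k}" using m by (simp add: pair_partitions_def)
  moreover have "\<Union> (m - {last_pair k}) = \<Union> m - last_pair k" using disj E by blast
  ultimately have "\<Union> (m - {last_pair k}) = {1..2*k}" by auto
  then show ?thesis using m by (auto simp: pair_partitions_def)
qed

section \<open>Monotone factorisations\<close>

text \<open>The composition that occurs in \<open>monotone_facts\<close>. The head of the list is
  the outermost factor, so the last transposition of the list is the first to act on a pair
  partition.\<close>

definition facts_perm :: "(nat \<times> nat) list \<Rightarrow> nat \<Rightarrow> nat" where
  "facts_perm ts = foldr (\<lambda>(a,b) f. Transposition.transpose a b \<circ> f) ts id"

lemma facts_perm_simps [simp]:
  "facts_perm [] = id"
  "facts_perm ((a,b) # ts) = Transposition.transpose a b \<circ> facts_perm ts"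
  by (simp_all add: facts_perm_def)

lemma facts_perm_snoc: "facts_perm (ts @ [(a,b)]) = facts_perm ts \<circ> Transposition.transpose a b"
  by (induction ts) auto

lemma facts_perm_fixes:
  "\<forall>(a,b)\<in>set ts. a < x \<and> b < x \<Longrightarrow> facts_perm ts x = x"
  by (induction ts) (auto simp: transpose_def)

lemma inj_facts_perm: "inj (facts_perm ts)"
  by (induction ts) (auto intro!: inj_compose inj_transpose)

lemma finite_monotone_facts: "finite (monotone_facts k m r)"
proof (rule finite_subset)
  show "monotone_facts k m r \<subseteq> {ts. set ts \<subseteq> {..2*k} \<times> {..2*k} \<and> length ts = r}"
    by (fastforce simp: monotone_facts_def)
qed (simp add: finite_lists_length_eq)

text \<open>The factorisations on \<open>2*k+2\<close> points that already live on the first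
  \<open>2*k\<close> points; see \<open>bounded_facts_eq\<close>.\<close>

definition bounded_facts :: "nat \<Rightarrow> nat set set \<Rightarrow> nat \<Rightarrow> (nat \<times> nat) list set" where
  "bounded_facts k m r = {ts \<in> monotone_facts (Suc k) m r. 2*k+1 \<notin> snd ` set ts}"

text \<open>If no larger entry equals \<open>2*k+1\<close>, then all of them are at most
  \<open>2*k\<close>, and every transposition fixes both \<open>2*k+1\<close> and
  \<open>2*k+2\<close>. The last pair of \<open>e_part (Suc k)\<close> can then only come from
  itself, so it must be a block of \<open>m\<close>, and it can be deleted on both sides.\<close>

lemma bounded_facts_eq:
  "bounded_facts k m r = (if last_pair k \<in> m then monotone_facts k (m - {last_pair k}) r else {})"
proof -
  let ?E = "last_pair k"
  \<comment> \<open>The parity condition excludes \<open>2*k+2\<close>, so \<open>2*k+1\<close> is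
    the only new value that a larger entry can take.\<close>
  have bnd: "b \<le> 2 * Suc k \<and> odd b \<and> b \<noteq> 2*k+1 \<longleftrightarrow> b \<le> 2*k \<and> odd b" for b :: nat
    by presburger
  have e: "e_part (Suc k) = insert ?E (e_part k)" by (simp add: e_part_def lessThan_Suc)
  have "2*k+1 \<notin> \<Union> (e_part k)" by (auto simp: e_part_def; presburger)
  then have nE: "?E \<notin> e_part k" by blast
  have act: "perm_act (facts_perm ts) m = e_part (Suc k) \<longleftrightarrow>
      ?E \<in> m \<and> perm_act (facts_perm ts) (m - {?E}) = e_part k"
    if ts: "\<forall>(a,b)\<in>set ts. a < 2*k+1 \<and> b < 2*k+1" for ts
  proof -
    have fE: "facts_perm ts ` ?E = ?E"
      using facts_perm_fixes[of ts "2*k+1"] facts_perm_fixes[of ts "2*k+2"] ts by fastforce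
    have injE: "facts_perm ts ` p = ?E \<longleftrightarrow> p = ?E" for p
      using inj_facts_perm fE by (metis inj_image_eq_iff)
    show ?thesis
    proof (cases "?E \<in> m")
      case True
      then have "perm_act (facts_perm ts) m = insert ?E (perm_act (facts_perm ts) (m - {?E}))"
        unfolding perm_act_def using fE by (metis image_insert insert_Diff)
      moreover have "?E \<notin> perm_act (facts_perm ts) (m - {?E})" using injE by (auto simp: perm_act_def)
      ultimately show ?thesis using True e nE by (metis insert_ident)
    next
      case False
      have "?E \<notin> perm_act (facts_perm ts) m"
      proof
        assume "?E \<in> perm_act (facts_perm ts) m"
        then have "?E \<in> (\<lambda>p. facts_perm ts ` p) ` m" by (simp only: perm_act_def)
        then obtain p where p: "?E = facts_perm ts ` p" "p \<in> m" by (rule imageE)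
        then have "p = ?E" using injE[of p] by (simp only: simp_thms)
        then show False using False p(2) by (simp only:)
      qed
      then show ?thesis using False e by blast
    qed
  qed
  have mem: "ts \<in> bounded_facts k m r \<longleftrightarrow> length ts = r
      \<and> (\<forall>(a,b)\<in>set ts. 1 \<le> a \<and> a < b \<and> b \<le> 2*k \<and> odd b)
      \<and> sorted (map snd ts) \<and> perm_act (facts_perm ts) m = e_part (Suc k)" for ts
  proof -
    have "(\<forall>(a,b)\<in>set ts. 1 \<le> a \<and> a < b \<and> b \<le> 2 * Suc k \<and> odd b) \<and> 2*k+1 \<notin> snd ` set ts \<longleftrightarrow>
        (\<forall>(a,b)\<in>set ts. 1 \<le> a \<and> a < b \<and> b \<le> 2 * Suc k \<and> odd b \<and> b \<noteq> 2*k+1)"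
      by (auto simp del: One_nat_def) force
    then show ?thesis
      unfolding bnd bounded_facts_def monotone_facts_def facts_perm_def by blast
  qed
  have "ts \<in> bounded_facts k m r \<longleftrightarrow> ?E \<in> m \<and> ts \<in> monotone_facts k (m - {?E}) r" for ts
  proof (cases "\<forall>(a,b)\<in>set ts. 1 \<le> a \<and> a < b \<and> b \<le> 2*k \<and> odd b")
    case True
    then have "\<forall>(a,b)\<in>set ts. a < 2*k+1 \<and> b < 2*k+1" by fastforce
    from act[OF this] True show ?thesis
      unfolding mem monotone_facts_def mem_Collect_eq facts_perm_def[symmetric] by argo
  next
    case False
    then show ?thesis unfolding mem monotone_facts_def mem_Collect_eq by argo
  qed
  then show ?thesis
    by (cases "?E \<in> m") (simp_all only: if_True if_False simp_thms set_eq_iff empty_iff)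
qed

lemma monotone_facts_sum_split:
  fixes f :: "(nat \<times> nat) list \<Rightarrow> real"
  shows "(\<Sum>ts\<in>monotone_facts (Suc k) m r. f ts) =
     (\<Sum>ts\<in>bounded_facts k m r. f ts) + (\<Sum>ts\<in>monotone_facts (Suc k) m r - bounded_facts k m r. f ts)"
  by (subst add.commute, rule sum.subset_diff) (auto simp: bounded_facts_def finite_monotone_facts)

text \<open>The value \<open>2*k+1\<close> is the largest possible larger entry, so by monotonicity
  it occurs in the last transposition if it occurs at all. That transposition acts first on
  \<open>m\<close>; removing it leaves a factorisation of \<open>odd_swap k a m\<close>. Conversely,
  appending it never destroys monotonicity.\<close>

lemma unbounded_facts_eq:
  "monotone_facts (Suc k) m (Suc r) - bounded_facts k m (Suc r) =
   (\<lambda>(a,us). us @ [(a, 2*k+1)]) ` (SIGMA a:{1..2*k}. monotone_facts (Suc k) (odd_swap k a m) r)"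
   (is "?L = ?R")
proof (rule Set.set_eqI)
  fix ts :: "(nat \<times> nat) list"
  show "ts \<in> ?L \<longleftrightarrow> ts \<in> ?R"
  proof (cases ts rule: rev_cases)
    case Nil
    then show ?thesis by (auto simp: monotone_facts_def)
  next
    case (snoc us ab)
    obtain a b where ab: "ab = (a,b)" by force
    have top: "b \<le> 2*k+1" if "b \<le> 2 * Suc k" "odd b" for b :: nat using that by presburger
    have "ts \<in> ?L \<longleftrightarrow> b = 2*k+1 \<and> ts \<in> monotone_facts (Suc k) m (Suc r)"
    proof
      assume L: "ts \<in> ?L"
      then have *: "ts \<in> monotone_facts (Suc k) m (Suc r)" "2*k+1 \<in> snd ` set ts"
        by (auto simp: bounded_facts_def)
      then have "2*k+1 \<le> b" using snoc ab by (auto simp: monotone_facts_def sorted_append)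
      moreover have "b \<le> 2 * Suc k" "odd b" using * snoc ab by (auto simp: monotone_facts_def)
      ultimately show "b = 2*k+1 \<and> ts \<in> monotone_facts (Suc k) m (Suc r)" using *(1) top by force
    qed (use snoc ab in \<open>auto simp: bounded_facts_def\<close>)
    also have "\<dots> \<longleftrightarrow> b = 2*k+1 \<and> a \<in> {1..2*k} \<and> us \<in> monotone_facts (Suc k) (odd_swap k a m) r"
    proof -
      have "sorted (map snd (us @ [(a,2*k+1)])) \<longleftrightarrow> sorted (map snd us)"
        if "\<forall>(a,b)\<in>set us. 1 \<le> a \<and> a < b \<and> b \<le> 2 * Suc k \<and> odd b"
        using that top by (fastforce simp: sorted_append)
      moreover have "perm_act (facts_perm (us @ [(a,2*k+1)])) m = perm_act (facts_perm us) (odd_swap k a m)"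
        by (simp add: facts_perm_snoc perm_act_compose)
      ultimately show ?thesis unfolding monotone_facts_def facts_perm_def[symmetric] snoc ab
        by (auto simp del: facts_perm_simps)
    qed
    also have "\<dots> \<longleftrightarrow> ts \<in> ?R" using snoc ab by (auto simp: image_iff)
    finally show ?thesis .
  qed
qed

section \<open>Weighted counts of factorisations and their recursion\<close>

definition hsum :: "real \<Rightarrow> nat \<Rightarrow> nat set set \<Rightarrow> nat \<Rightarrow> real" where
  "hsum t k m r = (\<Sum>ts\<in>monotone_facts k m r. t ^ hive ts)"

lemma hsum_eq_poly: "hsum t k m r = poly (map_poly of_int (hvec k m r)) t"
proof -
  have "map_poly of_int (hvec k m r) = (\<Sum>ts\<in>monotone_facts k m r. monom (1::real) (hive ts))"
    by (intro poly_eqI) (simp add: hvec_def coeff_map_poly coeff_sum if_distrib cong: if_cong)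
  then show ?thesis by (simp add: hsum_def poly_sum poly_monom)
qed

text \<open>The passage from \<open>W\<close> to \<open>W\<^sub>0\<close> in the overview, for an
  arbitrary function, so that it applies to Weingarten functions, to counts and to errors
  alike.\<close>

definition drop_last :: "(nat set set \<Rightarrow> real) \<Rightarrow> nat \<Rightarrow> nat set set \<Rightarrow> real" where
  "drop_last f k m = (if last_pair k \<in> m then f (m - {last_pair k}) else 0)"

lemma bounded_facts_sum:
  "(\<Sum>ts\<in>bounded_facts k m r. t ^ hive ts) = drop_last (\<lambda>m. hsum t k m r) k m"
  by (simp add: bounded_facts_eq drop_last_def hsum_def)

lemma hsum_0: "hsum t (Suc k) m 0 = drop_last (\<lambda>m. hsum t k m 0) k m"
proof -
  have "monotone_facts (Suc k) m 0 = bounded_facts k m 0" by (auto simp: bounded_facts_def monotone_facts_def)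
  then show ?thesis unfolding bounded_facts_sum[symmetric] by (simp add: hsum_def)
qed

text \<open>Factorisations are split by whether \<open>2*k+1\<close> occurs as a larger entry. If it
  does, the last transposition is removed. This lowers the hive number exactly when the rest is
  bounded, so bounded remainders have weight \<open>t\<close> times their own; the term with
  \<open>t - 1\<close> is the correction.\<close>

lemma hsum_Suc:
  "hsum t (Suc k) m (Suc r) = drop_last (\<lambda>m. hsum t k m (Suc r)) k m +
     (\<Sum>a=1..2*k. hsum t (Suc k) (odd_swap k a m) r + (t - 1) * drop_last (\<lambda>m. hsum t k m r) k (odd_swap k a m))"
proof -
  let ?F = "\<lambda>a. monotone_facts (Suc k) (odd_swap k a m) r"
  have hive: "hive (us @ [(a,2*k+1)]) = (if 2*k+1 \<in> snd ` set us then hive us else Suc (hive us))" for us a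
    by (auto simp: hive_def insert_absorb)
  have inner: "(\<Sum>us\<in>?F a. t ^ hive (us @ [(a,2*k+1)])) =
      hsum t (Suc k) (odd_swap k a m) r + (t - 1) * drop_last (\<lambda>m. hsum t k m r) k (odd_swap k a m)" for a
  proof -
    let ?B = "bounded_facts k (odd_swap k a m) r"
    \<comment> \<open>For a bounded \<open>us\<close> the appended entry \<open>2*k+1\<close> is a
      new value and costs a factor \<open>t\<close>; for any other \<open>us\<close> the value is
      already present.\<close>
    have "(\<Sum>us\<in>?F a. t ^ hive (us @ [(a,2*k+1)])) =
        (\<Sum>us\<in>?B. t * t ^ hive us) + (\<Sum>us\<in>?F a - ?B. t ^ hive us)"
      unfolding monotone_facts_sum_split[of _ k]
      by (intro arg_cong2[of _ _ _ _ "(+)"] sum.cong) (simp_all only: bounded_facts_def hive, auto)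
    also have "\<dots> = (\<Sum>us\<in>?B. t ^ hive us) + (\<Sum>us\<in>?F a - ?B. t ^ hive us) + (t - 1) * (\<Sum>us\<in>?B. t ^ hive us)"
      by (simp add: left_diff_distrib sum_distrib_left[symmetric])
    also have "(\<Sum>us\<in>?B. t ^ hive us) + (\<Sum>us\<in>?F a - ?B. t ^ hive us) = hsum t (Suc k) (odd_swap k a m) r"
      unfolding hsum_def by (rule monotone_facts_sum_split[symmetric])
    finally show ?thesis unfolding bounded_facts_sum .
  qed
  have inj: "inj_on (\<lambda>(a,us). us @ [(a, 2*k+1)]) (SIGMA a:{1..2*k}. ?F a)"
    by (auto simp: inj_on_def)
  have "hsum t (Suc k) m (Suc r) = (\<Sum>ts\<in>bounded_facts k m (Suc r). t ^ hive ts) +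
      (\<Sum>ts\<in>monotone_facts (Suc k) m (Suc r) - bounded_facts k m (Suc r). t ^ hive ts)"
    unfolding hsum_def by (rule monotone_facts_sum_split)
  also have "(\<Sum>ts\<in>monotone_facts (Suc k) m (Suc r) - bounded_facts k m (Suc r). t ^ hive ts) =
      (\<Sum>a=1..2*k. \<Sum>us\<in>?F a. t ^ hive (us @ [(a,2*k+1)]))"
    unfolding unbounded_facts_eq
    by (subst sum.reindex[OF inj]) (simp add: sum.Sigma finite_monotone_facts split_def)
  also have "\<dots> = (\<Sum>a=1..2*k. hsum t (Suc k) (odd_swap k a m) r +
      (t - 1) * drop_last (\<lambda>m. hsum t k m r) k (odd_swap k a m))"
    by (rule sum.cong[OF refl inner])
  finally show ?thesis unfolding bounded_facts_sum .
qed

lemma pair_partitions_0: "pair_partitions 0 = {{}}"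
proof -
  have "m = {}" if "m \<in> pair_partitions 0" for m
  proof (rule ccontr)
    assume "m \<noteq> {}"
    then obtain p where "p \<in> m" by blast
    then have "card p = 2" "p \<subseteq> {}" using that by (auto simp: pair_partitions_def)
    then show False by simp
  qed
  then show ?thesis by (auto simp: pair_partitions_def)
qed

lemma hsum_zero_points: "hsum t 0 {} r = (if r = 0 then 1 else 0)"
proof -
  have "monotone_facts 0 {} r = (if r = 0 then {[]} else {})"
    unfolding monotone_facts_def by (cases r) (fastforce simp: e_part_def perm_act_def length_Suc_conv)+
  then show ?thesis by (simp add: hsum_def hive_def)
qed

section \<open>Projection matrices\<close>

text \<open>A maximal independent set \<open>S\<close> of columns gives a rank factorisation
  \<open>A = B C\<close>, where the columns of \<open>B\<close> are the vectors in \<open>S\<close>.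
  Idempotency forces \<open>C B\<close> to be the identity of size \<open>card S\<close>, and the
  traces of \<open>B C\<close> and \<open>C B\<close> agree.\<close>

lemma (in vec_space) idempotent_trace_eq_rank:
  assumes A: "A \<in> carrier_mat n n" and idem: "A * A = A"
  shows "(\<Sum>j<n. A $$ (j,j)) = of_nat (rank A)"
proof -
  obtain S where S: "maximal S (\<lambda>T. T \<subseteq> set (cols A) \<and> lin_indpt T)"
    using maximal_exists[of "\<lambda>T. T \<subseteq> set (cols A) \<and> lin_indpt T" "card (set (cols A))" "{}"]
    by (meson List.finite_set card_mono empty_iff empty_subsetI finite_lin_indpt2 rev_finite_subset)
  then have sub: "S \<subseteq> set (cols A)" and ind: "lin_indpt S" by (auto simp: maximal_def)
  have fin: "finite S" using sub finite_subset by blast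
  have carr: "S \<subseteq> carrier_vec n" using sub cols_dim A by blast
  have in_span: "v \<in> span S" if v: "v \<in> set (cols A)" for v
  proof (rule ccontr)
    assume nv: "v \<notin> span S"
    have vc: "v \<in> carrier_vec n" using v cols_dim A by blast
    have vS: "v \<notin> S" using nv carr span_mem by auto
    have "lin_indpt (S \<union> {v})" using lin_dep_iff_in_span[of S v] carr ind vc vS nv by auto
    with S v sub vS show False unfolding maximal_def
      by (metis Un_insert_right insertI1 insert_subset subset_insertI sup_bot_right)
  qed
  have "\<exists>c. col A j = lincomb c S" if "j < n" for j
  proof -
    have "col A j \<in> set (cols A)" using that A by (auto simp: cols_def)
    then have "col A j \<in> span S" using in_span by blast
    then show ?thesis using finite_in_span[OF fin] carr by metis
  qed
  \<comment> \<open>The coefficients \<open>c j u\<close> are the entries of the factor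
    \<open>C\<close>.\<close>
  then obtain c where c: "\<And>j. j < n \<Longrightarrow> col A j = lincomb (c j) S" by metis
  have entry: "A $$ (i,j) = (\<Sum>u\<in>S. c j u * u $ i)" if "i < n" "j < n" for i j
  proof -
    have "A $$ (i,j) = col A j $ i" using that A by simp
    then show ?thesis using c[OF that(2)] lincomb_index[OF that(1) carr] by simp
  qed
  \<comment> \<open>This is \<open>C B = 1\<close>. A column \<open>v\<close> of \<open>A\<close>
    satisfies \<open>A v = v\<close>; expanding \<open>A v\<close> in \<open>S\<close> and comparing
    coefficients uses the independence of \<open>S\<close>.\<close>
  have dual: "(\<Sum>j<n. c j u * v $ j) = (if u = v then 1 else 0)" if u: "u \<in> S" and v: "v \<in> S" for u v
  proof -
    obtain l where l: "l < n" "v = col A l" using v sub A by (auto simp: cols_def)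
    let ?f = "\<lambda>u. (\<Sum>j<n. c j u * v $ j) - (if u = v then 1 else 0)"
    have "lincomb ?f S = 0\<^sub>v n"
    proof (rule eq_vecI)
      fix i assume "i < dim_vec (0\<^sub>v n)"
      then have i: "i < n" by simp
      have "v $ i = (A * A) $$ (i,l)" using l i A idem by simp
      also have "\<dots> = (\<Sum>j<n. A $$ (i,j) * v $ j)"
        using i l A by (simp add: scalar_prod_def lessThan_atLeast0)
      also have "\<dots> = (\<Sum>j<n. \<Sum>u\<in>S. c j u * v $ j * u $ i)"
        using entry i by (simp add: sum_distrib_right sum_distrib_left mult_ac)
      also have "\<dots> = (\<Sum>u\<in>S. (\<Sum>j<n. c j u * v $ j) * u $ i)"
        by (subst sum.swap) (simp add: sum_distrib_right)
      finally have vi: "v $ i = (\<Sum>u\<in>S. (\<Sum>j<n. c j u * v $ j) * u $ i)" .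
      have "lincomb ?f S $ i = (\<Sum>u\<in>S. ?f u * u $ i)" by (rule lincomb_index[OF i carr])
      also have "\<dots> = (\<Sum>u\<in>S. (\<Sum>j<n. c j u * v $ j) * u $ i) - (\<Sum>u\<in>S. (if u = v then u $ i else 0))"
        by (simp add: left_diff_distrib sum_subtractf if_distrib[of "\<lambda>x. x * _"] cong: if_cong)
      also have "\<dots> = 0" using vi fin v by simp
      finally show "lincomb ?f S $ i = 0\<^sub>v n $ i" using i by simp
    qed (use lincomb_dim[OF fin carr] in simp)
    then have "?f \<in> S \<rightarrow> {0}" using not_lindepD[OF ind fin subset_refl, of ?f] by auto
    then show ?thesis using u by (auto simp: Pi_def split: if_splits)
  qed
  have "(\<Sum>j<n. A $$ (j,j)) = (\<Sum>j<n. \<Sum>u\<in>S. c j u * u $ j)" using entry by simp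
  also have "\<dots> = (\<Sum>u\<in>S. \<Sum>j<n. c j u * u $ j)" by (rule sum.swap)
  also have "\<dots> = of_nat (card S)" using dual by simp
  also have "card S = rank A" using rank_card_indpt[OF A S] by simp
  finally show ?thesis .
qed

text \<open>These are the only facts about the projections that the moment computations need. The
  trace comes from the rank through \<open>idempotent_trace_eq_rank\<close>.\<close>

lemma Aspace_entries:
  assumes A: "A \<in> Aspace M N"
  shows Aspace_sym: "\<And>x y. x < N \<Longrightarrow> y < N \<Longrightarrow> A (x,y) = A (y,x)"
    and Aspace_idem: "\<And>x y. x < N \<Longrightarrow> y < N \<Longrightarrow> (\<Sum>l<N. A (x,l) * A (l,y)) = A (x,y)"
    and Aspace_bound: "\<And>x y. x < N \<Longrightarrow> y < N \<Longrightarrow> \<bar>A (x,y)\<bar> \<le> 1"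
    and Aspace_trace: "(\<Sum>x<N. A (x,x)) = real M"
proof -
  show sym: "A (x,y) = A (y,x)" if "x < N" "y < N" for x y
  proof -
    have "A (x,y) = mtrans N A (x,y)" using A by (simp add: Aspace_def)
    then show ?thesis using that by (simp add: mtrans_def)
  qed
  show idem: "(\<Sum>l<N. A (x,l) * A (l,y)) = A (x,y)" if "x < N" "y < N" for x y
  proof -
    have "A (x,y) = mmul N A A (x,y)" using A by (simp add: Aspace_def)
    then show ?thesis using that by (simp add: mmul_def)
  qed
  show "\<bar>A (x,y)\<bar> \<le> 1" if "x < N" "y < N" for x y
  proof -
    \<comment> \<open>By symmetry and idempotency the squares of row \<open>x\<close> add up to the
      diagonal entry \<open>A (x,x)\<close>. Taking \<open>z = x\<close> then bounds the diagonal
      entry by 1.\<close>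
    have sq: "(A (x,z))\<^sup>2 \<le> A (x,x)" if "z < N" for z
    proof -
      have "(A (x,z))\<^sup>2 \<le> (\<Sum>l<N. (A (x,l))\<^sup>2)"
        using that by (intro member_le_sum) auto
      also have "\<dots> = (\<Sum>l<N. A (x,l) * A (l,x))"
        using sym \<open>x < N\<close> by (intro sum.cong) (auto simp: power2_eq_square)
      finally show ?thesis using idem \<open>x < N\<close> by simp
    qed
    have "A (x,x) \<le> 1"
    proof (rule ccontr)
      assume "\<not> A (x,x) \<le> 1"
      then have "A (x,x) * 1 < A (x,x) * A (x,x)" by (intro mult_strict_left_mono) auto
      then show False using sq[OF \<open>x < N\<close>] by (simp add: power2_eq_square)
    qed
    then have "(A (x,y))\<^sup>2 \<le> 1" using sq[OF \<open>y < N\<close>] by linarith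
    then show ?thesis by (simp add: abs_square_le_1)
  qed
  let ?B = "mat N N (\<lambda>(i,j). A (i,j))"
  have B: "?B \<in> carrier_mat N N" by simp
  have "?B * ?B = ?B"
    using idem by (intro eq_matI) (auto simp: scalar_prod_def lessThan_atLeast0)
  then have "(\<Sum>j<N. ?B $$ (j,j)) = of_nat (vec_space.rank N ?B)"
    by (rule vec_space.idempotent_trace_eq_rank[OF B])
  then show "(\<Sum>x<N. A (x,x)) = real M" using A by (simp add: Aspace_def mrank_def)
qed

section \<open>Moments of the invariant measure\<close>

text \<open>The index function is arbitrary here, because the recursion passes through index
  functions that are constant on more than one block.\<close>

definition moment :: "rmat measure \<Rightarrow> nat \<Rightarrow> (nat \<Rightarrow> nat) \<Rightarrow> real" where
  "moment \<mu> k i = (\<integral>A. (\<Prod>s<k. A (i (2 * s + 1), i (2 * s + 2))) \<partial>\<mu>)"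

lemma WgA_eq_moment: "WgA \<mu> N k m = moment \<mu> k (index_fun N k m)"
  by (simp add: WgA_def moment_def Let_def)

lemma moment_cong:
  assumes "\<And>a. a \<in> {1..2*k} \<Longrightarrow> i a = j a"
  shows "moment \<mu> k i = moment \<mu> k j"
proof -
  have "(\<Prod>s<k. A (i (2 * s + 1), i (2 * s + 2))) = (\<Prod>s<k. A (j (2 * s + 1), j (2 * s + 2)))" for A :: rmat
    by (intro prod.cong) (auto simp: assms)
  then show ?thesis by (simp add: moment_def)
qed

section \<open>Finite sums, products and permutations\<close>

lemma prod_odd_even:
  fixes g :: "nat \<Rightarrow> real"
  shows "(\<Prod>s<k. g (2 * s + 1) * g (2 * s + 2)) = (\<Prod>a=1..2*k. g a)"
  by (induction k) (auto simp: numeral_2_eq_2 mult_ac)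

text \<open>Distributivity, with the choices of the two summation variables in all \<open>k\<close>
  factors collected into one function on the \<open>2*k\<close> positions. This turns a conjugated
  monomial into a sum of monomials.\<close>

lemma prod_double_sum_PiE:
  fixes f :: "'a \<times> 'a \<Rightarrow> real" and S :: "nat \<Rightarrow> 'a set"
  assumes fin: "\<And>a. finite (S a)"
  shows "(\<Prod>s<k. \<Sum>u\<in>S (2 * s + 1). \<Sum>v\<in>S (2 * s + 2). f (u,v)) =
    (\<Sum>j\<in>PiE {1..2*k} S. \<Prod>s<k. f (j (2 * s + 1), j (2 * s + 2)))"
proof -
  let ?T = "\<lambda>s. S (2 * s + 1) \<times> S (2 * s + 2)"
  have "(\<Prod>s<k. \<Sum>u\<in>S (2 * s + 1). \<Sum>v\<in>S (2 * s + 2). f (u,v)) = (\<Prod>s<k. \<Sum>p\<in>?T s. f p)"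
    using fin by (simp add: sum.cartesian_product split_def)
  also have "\<dots> = (\<Sum>g\<in>PiE {..<k} ?T. \<Prod>s<k. f (g s))"
    using fin by (intro prod_sum_PiE) auto
  \<comment> \<open>Position \<open>a\<close> belongs to factor \<open>(a-1) div 2\<close>; odd
    positions carry first coordinates and even ones second coordinates.\<close>
  also have "\<dots> = (\<Sum>j\<in>PiE {1..2*k} S. \<Prod>s<k. f (j (2 * s + 1), j (2 * s + 2)))"
  proof (rule sum.reindex_bij_witness[where
        i = "\<lambda>j. \<lambda>s\<in>{..<k}. (j (2 * s + 1), j (2 * s + 2))" and
        j = "\<lambda>g. \<lambda>a\<in>{1..2*k}. if odd a then fst (g ((a-1) div 2)) else snd (g ((a-1) div 2))"])
    fix g assume g: "g \<in> PiE {..<k} ?T"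
    let ?j = "\<lambda>a\<in>{1..2*k}. if odd a then fst (g ((a-1) div 2)) else snd (g ((a-1) div 2))"
    have o: "?j (2 * s + 1) = fst (g s)" and e: "?j (2 * s + 2) = snd (g s)" if "s < k" for s
      using that by auto
    show "(\<lambda>s\<in>{..<k}. (?j (2 * s + 1), ?j (2 * s + 2))) = g"
      using g by (intro extensionalityI[of _ "{..<k}"]) (auto simp: o e PiE_def)
    show "(\<Prod>s<k. f (?j (2 * s + 1), ?j (2 * s + 2))) = (\<Prod>s<k. f (g s))"
      by (intro prod.cong refl, subst o, simp, subst e, simp_all)
    show "?j \<in> PiE {1..2*k} S"
    proof (rule PiE_I)
      fix a assume a: "a \<in> {1..2*k}"
      define s where "s = (a-1) div 2"
      have s: "s < k" using a unfolding s_def by auto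
      have gs: "g s \<in> ?T s" using g s by auto
      have j: "?j a = (if odd a then fst (g s) else snd (g s))" using a by (simp add: s_def)
      have a_eq: "a = (if odd a then 2 * s + 1 else 2 * s + 2)" using a unfolding s_def by auto
      show "?j a \<in> S a"
      proof (cases "odd a")
        case True
        then have "fst (g s) \<in> S a" using a_eq gs by (metis mem_Times_iff)
        then show ?thesis unfolding j using True by simp
      next
        case False
        then have "snd (g s) \<in> S a" using a_eq gs by (metis mem_Times_iff)
        then show ?thesis unfolding j using False by simp
      qed
    qed auto
  next
    fix j assume j: "j \<in> PiE {1..2*k} S"
    let ?g = "\<lambda>s\<in>{..<k}. (j (2 * s + 1), j (2 * s + 2))"
    show "?g \<in> PiE {..<k} ?T"
      using j by (intro PiE_I) (auto simp: PiE_iff)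
    show "(\<lambda>a\<in>{1..2*k}. if odd a then fst (?g ((a-1) div 2)) else snd (?g ((a-1) div 2))) = j"
    proof (rule extensionalityI[of _ "{1..2*k}"])
      fix a assume a: "a \<in> {1..2*k}"
      have "(a-1) div 2 < k" "odd a \<Longrightarrow> 2*((a-1) div 2)+1 = a" "even a \<Longrightarrow> 2*((a-1) div 2)+2 = a"
        using a by auto
      then show "(\<lambda>a\<in>{1..2*k}. if odd a then fst (?g ((a-1) div 2)) else snd (?g ((a-1) div 2))) a = j a"
        using a by auto
    qed (use j in \<open>auto simp: PiE_def\<close>)
  qed
  finally show ?thesis .
qed

lemma sum_Pow_insert:
  fixes f :: "'a set \<Rightarrow> real"
  assumes "finite A" "x \<notin> A"
  shows "(\<Sum>U\<in>Pow (insert x A). f U) = (\<Sum>U\<in>Pow A. f U) + (\<Sum>U\<in>Pow A. f (insert x U))"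
proof -
  have inj: "inj_on (insert x) (Pow A)" using assms(2) by (auto simp: inj_on_def)
  have "Pow A \<inter> insert x ` Pow A = {}" using assms(2) by auto
  then show ?thesis using assms(1) by (simp add: Pow_insert sum.union_disjoint sum.reindex[OF inj])
qed

text \<open>Equal kernels make \<open>i a \<mapsto> j a\<close> a well-defined bijection between the
  images. The complements of the images in the finite set \<open>S\<close> have equal size, so any
  bijection between them completes it.\<close>

lemma extend_to_permutation:
  assumes fin: "finite S" and ran: "i ` I \<subseteq> S" "j ` I \<subseteq> S"
    and ker: "\<And>a b. a \<in> I \<Longrightarrow> b \<in> I \<Longrightarrow> i a = i b \<longleftrightarrow> j a = j b"
  obtains \<pi> where "bij_betw \<pi> S S" "\<And>a. a \<in> I \<Longrightarrow> \<pi> (i a) = j a"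
proof -
  define g where "g x = j (SOME a. a \<in> I \<and> i a = x)" for x
  have g: "g (i a) = j a" if "a \<in> I" for a
  proof -
    have "(SOME b. b \<in> I \<and> i b = i a) \<in> I \<and> i (SOME b. b \<in> I \<and> i b = i a) = i a"
      by (rule someI[of _ a]) (use that in auto)
    then show ?thesis using ker that by (auto simp: g_def)
  qed
  have bg: "bij_betw g (i ` I) (j ` I)"
    by (rule bij_betw_imageI) (use g ker in \<open>auto simp: inj_on_def image_image\<close>)
  have "card (S - i ` I) = card (S - j ` I)"
    using bij_betw_same_card[OF bg] fin ran by (simp add: card_Diff_subset finite_subset)
  then obtain h where h: "bij_betw h (S - i ` I) (S - j ` I)"
    using fin by (metis finite_Diff finite_same_card_bij)
  let ?p = "\<lambda>x. if x \<in> i ` I then g x else h x"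
  have "bij_betw ?p (i ` I) (j ` I)"
    using bg by (rule bij_betw_cong[THEN iffD1, rotated]) auto
  moreover have "bij_betw ?p (S - i ` I) (S - j ` I)"
    using h by (rule bij_betw_cong[THEN iffD1, rotated]) auto
  ultimately have "bij_betw ?p (i ` I \<union> (S - i ` I)) (j ` I \<union> (S - j ` I))"
    by (rule bij_betw_combine) auto
  moreover have "i ` I \<union> (S - i ` I) = S" "j ` I \<union> (S - j ` I) = S" using ran by auto
  ultimately have "bij_betw ?p S S" by simp
  then show ?thesis using that[of ?p] g by auto
qed

text \<open>Evaluates an entry of a conjugated matrix when the relevant rows of the orthogonal
  matrix are constant on their supports \<open>S\<close> and \<open>T\<close>.\<close>

lemma sum_sum_indicator:
  fixes h :: "nat \<times> nat \<Rightarrow> real"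
  assumes "S \<subseteq> {..<N}" "T \<subseteq> {..<N}"
  shows "(\<Sum>u<N. \<Sum>v<N. (if u \<in> S then c else 0) * (if v \<in> T then d else 0) * h (u,v)) =
    c * d * (\<Sum>u\<in>S. \<Sum>v\<in>T. h (u,v))"
proof -
  have "(\<Sum>u<N. \<Sum>v<N. (if u \<in> S then c else 0) * (if v \<in> T then d else 0) * h (u,v)) =
      (\<Sum>u\<in>S. \<Sum>v<N. c * (if v \<in> T then d else 0) * h (u,v))"
    using assms by (intro sum.mono_neutral_cong_right) auto
  also have "\<dots> = (\<Sum>u\<in>S. \<Sum>v\<in>T. c * d * h (u,v))"
    using assms by (intro sum.cong refl sum.mono_neutral_cong_right) auto
  finally show ?thesis by (simp add: sum_distrib_left)
qed

lemma sum_sum_delta: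
  fixes h :: "nat \<times> nat \<Rightarrow> real"
  assumes "x < N" "y < N"
  shows "(\<Sum>u<N. \<Sum>v<N. (if u = x then c else 0) * (if v = y then d else 0) * h (u,v)) = c * d * h (x,y)"
  using sum_sum_indicator[of "{x}" N "{y}" c d h] assms by simp

section \<open>Invariance of moments under orthogonal conjugation\<close>

locale haar_projection =
  fixes M N :: nat and \<mu> :: "rmat measure"
  assumes haar: "haar_A M N \<mu>"
begin

sublocale prob_space \<mu> using haar by (simp add: haar_A_def)

lemma sets_mu: "sets \<mu> = sets (mat_space N)" using haar by (simp add: haar_A_def)

lemma AE_Aspace: "AE A in \<mu>. A \<in> Aspace M N" using haar by (simp add: haar_A_def)

lemma entry_mat_space_measurable: "x < N \<Longrightarrow> y < N \<Longrightarrow> (\<lambda>A. A (x,y)) \<in> borel_measurable (mat_space N)"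
  unfolding mat_space_def by (rule measurable_component_singleton) auto

lemma entry_measurable: "x < N \<Longrightarrow> y < N \<Longrightarrow> (\<lambda>A. A (x,y)) \<in> borel_measurable \<mu>"
  using entry_mat_space_measurable measurable_cong_sets[OF sets_mu refl] by blast

definition in_range :: "nat \<Rightarrow> (nat \<Rightarrow> nat) \<Rightarrow> bool" where
  "in_range k i \<longleftrightarrow> (\<forall>a\<in>{1..2*k}. i a < N)"

lemma in_rangeD: "in_range k i \<Longrightarrow> s < k \<Longrightarrow> i (2 * s + 1) < N \<and> i (2 * s + 2) < N"
  by (auto simp: in_range_def)

lemma in_range_Suc: "in_range (Suc k) i \<Longrightarrow> in_range k i"
  by (auto simp: in_range_def)

lemma monomial_bound:
  assumes "in_range k i" "A \<in> Aspace M N"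
  shows "\<bar>\<Prod>s<k. A (i (2 * s + 1), i (2 * s + 2))\<bar> \<le> 1"
  unfolding abs_prod using assms in_rangeD[OF assms(1)] Aspace_bound[OF assms(2)]
  by (intro prod_le_1) auto

lemma integrable_monomial:
  assumes "in_range k i"
  shows "integrable \<mu> (\<lambda>A. \<Prod>s<k. A (i (2 * s + 1), i (2 * s + 2)))"
proof (rule integrable_const_bound[where B = 1])
  show "AE A in \<mu>. norm (\<Prod>s<k. A (i (2 * s + 1), i (2 * s + 2))) \<le> 1"
    using AE_Aspace by eventually_elim (unfold real_norm_def, rule monomial_bound[OF assms])
  show "(\<lambda>A. \<Prod>s<k. A (i (2 * s + 1), i (2 * s + 2))) \<in> borel_measurable \<mu>"
    using in_rangeD[OF assms] by (intro borel_measurable_prod entry_measurable) auto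
qed

lemma moment_bound:
  assumes "in_range k i"
  shows "\<bar>moment \<mu> k i\<bar> \<le> 1"
proof -
  have "\<bar>moment \<mu> k i\<bar> \<le> (\<integral>A. \<bar>\<Prod>s<k. A (i (2 * s + 1), i (2 * s + 2))\<bar> \<partial>\<mu>)"
    unfolding moment_def by (rule integral_abs_bound)
  also have "\<dots> \<le> 1"
  proof (intro integral_le_const integrable_abs integrable_monomial assms)
    show "AE A in \<mu>. \<bar>\<Prod>s<k. A (i (2 * s + 1), i (2 * s + 2))\<bar> \<le> 1"
      using AE_Aspace by eventually_elim (rule monomial_bound[OF assms])
  qed
  finally show ?thesis .
qed

text \<open>Change of variables along conjugation by \<open>Q\<close>, which preserves the measure.
  Every later use of invariance goes through this formula with a specific \<open>Q\<close>.\<close>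

lemma moment_conj:
  assumes Q: "orthogonal_mat N Q" and i: "in_range k i"
  shows "moment \<mu> k i = (\<integral>A. (\<Prod>s<k. \<Sum>u<N. \<Sum>v<N. Q (i (2 * s + 1),u) * Q (i (2 * s + 2),v) * A (u,v)) \<partial>\<mu>)"
proof -
  let ?c = "\<lambda>A. mmul N (mmul N Q A) (mtrans N Q)"
  have ent: "?c A (x,y) = (\<Sum>u<N. \<Sum>v<N. Q (x,u) * Q (y,v) * A (u,v))" if "x < N" "y < N" for A x y
  proof -
    have "?c A (x,y) = (\<Sum>v<N. (\<Sum>u<N. Q (x,u) * A (u,v)) * Q (y,v))"
      using that by (simp add: mmul_def mtrans_def)
    also have "\<dots> = (\<Sum>v<N. \<Sum>u<N. Q (x,u) * Q (y,v) * A (u,v))"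
      by (simp add: sum_distrib_right sum_distrib_left mult_ac)
    finally show ?thesis by (subst sum.swap)
  qed
  have meas: "?c \<in> measurable \<mu> (mat_space N)"
    unfolding mat_space_def
  proof (rule measurable_PiM_single')
    fix xy assume "xy \<in> {..<N} \<times> {..<N}"
    then obtain x y where xy: "xy = (x,y)" "x < N" "y < N" by auto
    show "(\<lambda>A. ?c A xy) \<in> borel_measurable \<mu>"
      unfolding xy(1) ent[OF xy(2,3)] using entry_measurable
      by (intro borel_measurable_sum borel_measurable_times borel_measurable_const) auto
  next
    have "?c A \<in> extensional ({..<N} \<times> {..<N})" for A by (simp add: mmul_def[of N "mmul N Q A"])
    then show "?c \<in> space \<mu> \<rightarrow> PiE ({..<N} \<times> {..<N}) (\<lambda>_. space borel)" by (simp add: PiE_def)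
  qed
  have "moment \<mu> k i = (\<integral>A. (\<Prod>s<k. A (i (2 * s + 1), i (2 * s + 2))) \<partial>distr \<mu> (mat_space N) ?c)"
    using haar Q by (simp add: moment_def haar_A_def)
  also have "\<dots> = (\<integral>A. (\<Prod>s<k. ?c A (i (2 * s + 1), i (2 * s + 2))) \<partial>\<mu>)"
    using in_rangeD[OF i]
    by (intro integral_distr meas borel_measurable_prod entry_mat_space_measurable) auto
  also have "\<dots> = (\<integral>A. (\<Prod>s<k. \<Sum>u<N. \<Sum>v<N. Q (i (2 * s + 1),u) * Q (i (2 * s + 2),v) * A (u,v)) \<partial>\<mu>)"
    by (intro Bochner_Integration.integral_cong prod.cong refl ent) (use in_rangeD[OF i] in auto)
  finally show ?thesis .
qed

lemma orthogonal_matI: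
  assumes "\<And>x y. x < N \<Longrightarrow> y < N \<Longrightarrow> (\<Sum>l<N. q x l * q y l) = (if x = y then 1 else 0)"
  shows "orthogonal_mat N (restrict (\<lambda>(x,y). q x y) ({..<N} \<times> {..<N}))"
proof -
  let ?Q = "restrict (\<lambda>(x,y). q x y) ({..<N} \<times> {..<N})"
  have "?Q \<in> space (mat_space N)" by (simp add: mat_space_def space_PiM PiE_def)
  moreover have "mmul N ?Q (mtrans N ?Q) = mid N"
    unfolding mmul_def mid_def by (rule restrict_ext) (auto simp: mtrans_def assms)
  ultimately show ?thesis by (simp add: orthogonal_mat_def)
qed

text \<open>Conjugation by the permutation matrix of \<open>\<pi>\<close> relabels rows and columns
  simultaneously.\<close>

lemma moment_permute:
  assumes \<pi>: "bij_betw \<pi> {..<N} {..<N}" and i: "in_range k i"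
  shows "moment \<mu> k (\<pi> \<circ> i) = moment \<mu> k i"
proof -
  let ?Q = "restrict (\<lambda>(x,y). if y = \<pi> x then 1 else 0) ({..<N} \<times> {..<N}) :: rmat"
  have inj: "\<pi> x = \<pi> y \<longleftrightarrow> x = y" and ran: "\<pi> x < N" if "x < N" "y < N" for x y
    using \<pi> that by (auto simp: bij_betw_def inj_on_def)
  have "orthogonal_mat N ?Q"
    by (rule orthogonal_matI[where q = "\<lambda>x y. if y = \<pi> x then 1 else 0"])
      (use inj ran in \<open>auto simp: if_distrib[of "\<lambda>z. z * _"] cong: if_cong\<close>)
  from moment_conj[OF this i]
  have "moment \<mu> k i = (\<integral>A. (\<Prod>s<k. \<Sum>u<N. \<Sum>v<N. ?Q (i (2 * s + 1),u) * ?Q (i (2 * s + 2),v) * A (u,v)) \<partial>\<mu>)" .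
  also have "\<dots> = moment \<mu> k (\<pi> \<circ> i)" unfolding moment_def
  proof (intro Bochner_Integration.integral_cong prod.cong refl)
    fix A :: rmat and s assume "s \<in> {..<k}"
    then have r: "i (2 * s + 1) < N" "i (2 * s + 2) < N" using in_rangeD[OF i] by auto
    have "(\<Sum>u<N. \<Sum>v<N. ?Q (x,u) * ?Q (y,v) * A (u,v)) = A (\<pi> x, \<pi> y)" if "x < N" "y < N" for x y
    proof -
      have "(\<Sum>u<N. \<Sum>v<N. ?Q (x,u) * ?Q (y,v) * A (u,v)) =
          (\<Sum>u<N. \<Sum>v<N. (if u = \<pi> x then 1 else 0) * (if v = \<pi> y then 1 else 0) * A (u,v))"
        using that by (intro sum.cong) auto
      also have "\<dots> = 1 * 1 * A (\<pi> x, \<pi> y)" using ran that by (intro sum_sum_delta) auto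
      also have "\<dots> = A (\<pi> x, \<pi> y)" by simp
      finally show ?thesis .
    qed
    then show "(\<Sum>u<N. \<Sum>v<N. ?Q (i (2 * s + 1),u) * ?Q (i (2 * s + 2),v) * A (u,v)) =
        A ((\<pi> \<circ> i) (2 * s + 1), (\<pi> \<circ> i) (2 * s + 2))" using r by simp
  qed
  finally show ?thesis by simp
qed

text \<open>Two index functions with the same coincidences differ by a permutation of the index
  range, so \<open>moment_permute\<close> applies.\<close>

lemma moment_same_kernel:
  assumes i: "in_range k i" and j: "in_range k j"
    and ker: "\<And>a b. a \<in> {1..2*k} \<Longrightarrow> b \<in> {1..2*k} \<Longrightarrow> i a = i b \<longleftrightarrow> j a = j b"
  shows "moment \<mu> k i = moment \<mu> k j"
proof -
  have ran: "i ` {1..2*k} \<subseteq> {..<N}" "j ` {1..2*k} \<subseteq> {..<N}" using i j by (auto simp: in_range_def)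
  obtain \<pi> where \<pi>: "bij_betw \<pi> {..<N} {..<N}" "\<And>a. a \<in> {1..2*k} \<Longrightarrow> \<pi> (i a) = j a"
    using extend_to_permutation[OF _ ran ker] by blast
  have "moment \<mu> k j = moment \<mu> k (\<pi> \<circ> i)" by (rule moment_cong) (use \<pi> in auto)
  then show ?thesis using moment_permute[OF \<pi>(1) i] by simp
qed

text \<open>Conjugation by the diagonal matrix with \<open>-1\<close> at \<open>w\<close> and
  \<open>1\<close> elsewhere multiplies the monomial by \<open>-1\<close> once for each occurrence
  of \<open>w\<close>. With an odd number of occurrences the moment equals its own negative.\<close>

lemma moment_odd_index:
  assumes i: "in_range k i" and odd: "odd (card {a\<in>{1..2*k}. i a = w})"
  shows "moment \<mu> k i = 0"
proof -
  define e where "e x = (if x = w then -1 else 1 :: real)" for x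
  let ?Q = "restrict (\<lambda>(x,y). if x = y then e x else 0) ({..<N} \<times> {..<N}) :: rmat"
  have "orthogonal_mat N ?Q"
    by (rule orthogonal_matI[where q = "\<lambda>x y. if x = y then e x else 0"])
      (auto simp: e_def if_distrib[of "\<lambda>z. z * _"] cong: if_cong)
  from moment_conj[OF this i]
  have "moment \<mu> k i = (\<integral>A. (\<Prod>s<k. \<Sum>u<N. \<Sum>v<N. ?Q (i (2 * s + 1),u) * ?Q (i (2 * s + 2),v) * A (u,v)) \<partial>\<mu>)" .
  also have "\<dots> = (\<integral>A. (\<Prod>s<k. e (i (2 * s + 1)) * e (i (2 * s + 2)) * A (i (2 * s + 1), i (2 * s + 2))) \<partial>\<mu>)"
  proof (intro Bochner_Integration.integral_cong prod.cong refl)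
    fix A :: rmat and s assume "s \<in> {..<k}"
    then have r: "i (2 * s + 1) < N" "i (2 * s + 2) < N" using in_rangeD[OF i] by auto
    have "(\<Sum>u<N. \<Sum>v<N. ?Q (x,u) * ?Q (y,v) * A (u,v)) = e x * e y * A (x,y)" if "x < N" "y < N" for x y
    proof -
      have "(\<Sum>u<N. \<Sum>v<N. ?Q (x,u) * ?Q (y,v) * A (u,v)) =
          (\<Sum>u<N. \<Sum>v<N. (if u = x then e x else 0) * (if v = y then e y else 0) * A (u,v))"
        using that by (intro sum.cong) auto
      also have "\<dots> = e x * e y * A (x,y)" by (rule sum_sum_delta[OF that])
      finally show ?thesis .
    qed
    then show "(\<Sum>u<N. \<Sum>v<N. ?Q (i (2 * s + 1),u) * ?Q (i (2 * s + 2),v) * A (u,v)) =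
        e (i (2 * s + 1)) * e (i (2 * s + 2)) * A (i (2 * s + 1), i (2 * s + 2))" using r by simp
  qed
  also have "\<dots> = (\<Prod>s<k. e (i (2 * s + 1)) * e (i (2 * s + 2))) * moment \<mu> k i"
    by (simp add: moment_def prod.distrib)
  also have "(\<Prod>s<k. e (i (2 * s + 1)) * e (i (2 * s + 2))) = (\<Prod>a=1..2*k. e (i a))"
    by (rule prod_odd_even)
  also have "\<dots> = (\<Prod>a\<in>{a\<in>{1..2*k}. i a = w}. -1)"
    by (rule prod.mono_neutral_cong_right) (auto simp: e_def)
  also have "\<dots> = -1" using odd by simp
  finally show ?thesis by simp
qed

end

section \<open>Index functions adapted to a pair partition\<close>

definition matches :: "nat \<Rightarrow> nat \<Rightarrow> (nat \<Rightarrow> nat) \<Rightarrow> nat set set \<Rightarrow> bool" where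
  "matches N k i m \<longleftrightarrow> (\<forall>a\<in>{1..2*k}. i a < N) \<and>
      (\<forall>a\<in>{1..2*k}. \<forall>b\<in>{1..2*k}. a \<noteq> b \<longrightarrow> (i a = i b \<longleftrightarrow> {a,b} \<in> m))"

lemma card_pair_partition:
  assumes m: "m \<in> pair_partitions k"
  shows "finite m" "card m = k"
proof -
  have U: "\<Union> m = {1..2*k}" and c2: "\<And>p. p \<in> m \<Longrightarrow> card p = 2" using m by (auto simp: pair_partitions_def)
  show "finite m" using U by (metis finite_UnionD finite_atLeastAtMost)
  have "card (\<Union> m) = sum card m"
  proof (rule card_Union_disjoint)
    show "pairwise disjnt m" using m by (auto simp: pairwise_def disjnt_def pair_partitions_def)
  qed (metis c2 card.infinite zero_neq_numeral)
  also have "\<dots> = 2 * card m" using c2 by simp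
  finally show "card m = k" using U by simp
qed

text \<open>The \<open>k\<close> blocks receive distinct labels below \<open>N\<close>, which is
  possible since \<open>k \<le> N\<close>. This justifies the choice operator in
  \<open>index_fun\<close>.\<close>

lemma matches_exists:
  assumes m: "m \<in> pair_partitions k" and N: "k \<le> N"
  shows "\<exists>i. matches N k i m"
proof -
  obtain e where e: "inj_on e m" "e ` m \<subseteq> {..<N}"
    using card_le_inj[of m "{..<N}"] card_pair_partition[OF m] N by auto
  have "\<exists>p. p \<in> m \<and> a \<in> p" if "a \<in> {1..2*k}" for a using m that unfolding pair_partitions_def by blast
  then obtain blk where blk: "\<And>a. a \<in> {1..2*k} \<Longrightarrow> blk a \<in> m \<and> a \<in> blk a" by metis
  have "e (blk a) = e (blk b) \<longleftrightarrow> {a,b} \<in> m" if a: "a \<in> {1..2*k}" and b: "b \<in> {1..2*k}" and "a \<noteq> b" for a b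
  proof
    assume "e (blk a) = e (blk b)"
    then have "blk a = blk b" using e(1) blk a b by (meson inj_onD)
    then have "a \<in> blk a" "b \<in> blk a" "card (blk a) = 2" using blk a b m by (auto simp: pair_partitions_def)
    then have "blk a = {a,b}" using \<open>a \<noteq> b\<close> by (auto simp: card_2_iff)
    then show "{a,b} \<in> m" using blk a by metis
  next
    assume ab: "{a,b} \<in> m"
    have "blk a = {a,b}" using pair_partition_disjoint[OF m _ ab] blk[OF a] by blast
    moreover have "blk b = {a,b}" using pair_partition_disjoint[OF m _ ab] blk[OF b] by blast
    ultimately
    show "e (blk a) = e (blk b)" by simp
  qed
  moreover have "e (blk a) < N" if "a \<in> {1..2*k}" for a using e(2) blk[OF that] by blast
  ultimately have "matches N k (e \<circ> blk) m" by (simp add: matches_def)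
  then show ?thesis by blast
qed

lemma matches_index_fun:
  assumes "m \<in> pair_partitions k" "k \<le> N"
  shows "matches N k (index_fun N k m) m"
  using someI_ex[OF matches_exists[OF assms]] by (simp add: index_fun_def matches_def)

lemma matches_transpose:
  assumes "matches N k i m" "a \<in> {1..2*k}" "b \<in> {1..2*k}"
  shows "matches N k (i \<circ> Transposition.transpose a b) (perm_act (Transposition.transpose a b) m)"
proof -
  let ?t = "Transposition.transpose a b"
  have ran: "?t x \<in> {1..2*k}" if "x \<in> {1..2*k}" for x using assms(2,3) that by (auto simp: Transposition.transpose_def)
  have "?t x = ?t y \<longleftrightarrow> x = y" for x y by (metis transpose_involutory)
  then show ?thesis using assms(1) ran unfolding matches_def pair_in_transpose_iff by simp
qed

section \<open>Moments with coinciding indices\<close>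

context haar_projection
begin

text \<open>The orthogonal matrix sends row \<open>v\<close> to the normalised sum of the unit
  vectors at \<open>v\<close> and \<open>w\<close>. Multiplying out, each position with index
  \<open>v\<close> independently keeps \<open>v\<close> or switches to \<open>w\<close>;
  \<open>U\<close> records the positions that switch.\<close>

lemma moment_rotate:
  assumes i: "in_range k i" and v: "v < N" and w: "w < N" and vw: "v \<noteq> w" and wi: "w \<notin> i ` {1..2*k}"
    and P: "P = {a\<in>{1..2*k}. i a = v}"
  shows "moment \<mu> k i = (1 / sqrt 2) ^ card P * (\<Sum>U\<in>Pow P. moment \<mu> k (\<lambda>a. if a \<in> U then w else i a))"
proof -
  define c where "c = 1 / sqrt 2"
  have cc: "c * c = 1 / 2" by (simp add: c_def)
  define q where "q x y = (if x = v then (if y \<in> {v,w} then c else 0) else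
      if x = w then (if y = v then c else if y = w then - c else 0) else if x = y then 1 else 0)" for x y
  let ?Q = "restrict (\<lambda>(x,y). q x y) ({..<N} \<times> {..<N}) :: rmat"
  have Q: "orthogonal_mat N ?Q"
  proof (rule orthogonal_matI)
    fix x y assume xy: "x < N" "y < N"
    consider "x \<notin> {v,w}" | "y \<notin> {v,w}" | "x \<in> {v,w}" "y \<in> {v,w}" by blast
    then show "(\<Sum>l<N. q x l * q y l) = (if x = y then 1 else 0)"
    proof cases
      case 1
      then have "(\<Sum>l<N. q x l * q y l) = (\<Sum>l<N. if x = l then q y l else 0)"
        by (intro sum.cong) (auto simp: q_def)
      also have "\<dots> = q y x" using xy by simp
      finally show ?thesis using 1 by (auto simp: q_def)
    next
      case 2
      then have "(\<Sum>l<N. q x l * q y l) = (\<Sum>l<N. if y = l then q x l else 0)"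
        by (intro sum.cong) (auto simp: q_def)
      also have "\<dots> = q x y" using xy by simp
      finally show ?thesis using 2 by (auto simp: q_def)
    next
      case 3
      then have "(\<Sum>l<N. q x l * q y l) = (\<Sum>l\<in>{v,w}. q x l * q y l)"
        using v w by (intro sum.mono_neutral_right) (auto simp: q_def)
      also have "\<dots> = q x v * q y v + q x w * q y w" using vw by simp
      also have "\<dots> = (if x = y then 1 else 0)"
      proof -
        have "q v v = c" "q v w = c" "q w v = c" "q w w = - c" using vw by (simp_all add: q_def)
        then show ?thesis using 3 vw vw[symmetric] cc by (elim insertE emptyE) simp_all
      qed
      finally show ?thesis .
    qed
  qed
  \<comment> \<open>For \<open>x \<noteq> w\<close>, row \<open>x\<close> of \<open>q\<close> has
    support \<open>S x\<close> and the constant value \<open>\<kappa> x\<close> on it.\<close>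
  define S where "S x = (if x = v then {v,w} else {x})" for x
  define \<kappa> where "\<kappa> x = (if x = v then c else 1)" for x
  have Srange: "S x \<subseteq> {..<N}" if "x < N" for x using that v w by (auto simp: S_def)
  let ?J = "PiE {1..2*k} (\<lambda>a. S (i a))"
  have J: "in_range k j" if "j \<in> ?J" for j
    using that Srange i unfolding in_range_def PiE_iff by blast
  have expand: "(\<Prod>s<k. \<Sum>u<N. \<Sum>v<N. ?Q (i (2 * s + 1),u) * ?Q (i (2 * s + 2),v) * A (u,v)) =
      (\<Prod>a=1..2*k. \<kappa> (i a)) * (\<Sum>j\<in>?J. \<Prod>s<k. A (j (2 * s + 1), j (2 * s + 2)))" for A :: rmat
  proof -
    have row: "?Q (x,u) = (if u \<in> S x then \<kappa> x else 0)" if "x < N" "u < N" "x \<noteq> w" for x u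
      using that by (auto simp: q_def S_def \<kappa>_def)
    have ent: "(\<Sum>u<N. \<Sum>v<N. ?Q (x,u) * ?Q (y,v) * A (u,v)) = \<kappa> x * \<kappa> y * (\<Sum>u\<in>S x. \<Sum>v\<in>S y. A (u,v))"
      if "x < N" "y < N" "x \<noteq> w" "y \<noteq> w" for x y
      unfolding sum_sum_indicator[symmetric, OF Srange[OF that(1)] Srange[OF that(2)]]
      using row[OF that(1) _ that(3)] row[OF that(2) _ that(4)]
      by (intro sum.cong refl) (simp only: lessThan_iff)
    have "(\<Prod>s<k. \<Sum>u<N. \<Sum>v<N. ?Q (i (2 * s + 1),u) * ?Q (i (2 * s + 2),v) * A (u,v)) =
        (\<Prod>s<k. \<kappa> (i (2 * s + 1)) * \<kappa> (i (2 * s + 2)) * (\<Sum>u\<in>S (i (2 * s + 1)). \<Sum>v\<in>S (i (2 * s + 2)). A (u,v)))"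
    proof (intro prod.cong refl ent)
      fix s assume "s \<in> {..<k}"
      then have "2 * s + 1 \<in> {1..2*k}" "2 * s + 2 \<in> {1..2*k}" by auto
      then show "i (2 * s + 1) < N" "i (2 * s + 2) < N" "i (2 * s + 1) \<noteq> w" "i (2 * s + 2) \<noteq> w"
        using i wi by (auto simp: in_range_def simp del: atLeastAtMost_iff)
    qed
    also have "\<dots> = (\<Prod>a=1..2*k. \<kappa> (i a)) * (\<Sum>j\<in>?J. \<Prod>s<k. A (j (2 * s + 1), j (2 * s + 2)))"
      unfolding prod.distrib[of "\<lambda>s. \<kappa> (i (2 * s + 1)) * \<kappa> (i (2 * s + 2))"]
      by (intro arg_cong2[of _ _ _ _ "(*)"] prod_odd_even prod_double_sum_PiE) (auto simp: S_def)
    finally show ?thesis .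
  qed
  have "moment \<mu> k i = (\<Prod>a=1..2*k. \<kappa> (i a)) * (\<Sum>j\<in>?J. moment \<mu> k j)"
    unfolding moment_conj[OF Q i] expand
    by (simp add: moment_def J integrable_monomial Bochner_Integration.integral_sum del: One_nat_def add_2_eq_Suc')
  also have "(\<Prod>a=1..2*k. \<kappa> (i a)) = (\<Prod>a\<in>P. c)"
    unfolding P by (rule prod.mono_neutral_cong_right) (auto simp: \<kappa>_def)
  \<comment> \<open>Since \<open>w\<close> is not a value of \<open>i\<close>, the set of switched
    positions can be read off as the fibre of \<open>j\<close> over \<open>w\<close>.\<close>
  also have "(\<Sum>j\<in>?J. moment \<mu> k j) = (\<Sum>U\<in>Pow P. moment \<mu> k (\<lambda>a. if a \<in> U then w else i a))"
  proof (rule sum.reindex_bij_witness[where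
        i = "\<lambda>U. \<lambda>a\<in>{1..2*k}. if a \<in> U then w else i a" and j = "\<lambda>j. {a\<in>{1..2*k}. j a = w}"])
    fix j assume j: "j \<in> ?J"
    have ja: "j a = (if j a = w then w else i a)" if "a \<in> {1..2*k}" for a
      using PiE_mem[OF j that] by (auto simp: S_def split: if_splits)
    show "(\<lambda>a\<in>{1..2*k}. if a \<in> {a\<in>{1..2*k}. j a = w} then w else i a) = j"
    proof (rule extensionalityI[of _ "{1..2*k}"])
      show "j \<in> extensional {1..2*k}" using j by (simp only: PiE_iff)
    qed (use ja in auto)
    show "{a\<in>{1..2*k}. j a = w} \<in> Pow P"
    proof -
      have "i a = v" if a: "a \<in> {1..2*k}" "j a = w" for a
      proof -
        have "i a \<noteq> w" using wi a(1) by blast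
        then show ?thesis using PiE_mem[OF j a(1)] a(2) by (auto simp: S_def split: if_splits)
      qed
      then show ?thesis unfolding P by blast
    qed
    show "moment \<mu> k (\<lambda>a. if a \<in> {a\<in>{1..2*k}. j a = w} then w else i a) = moment \<mu> k j"
      by (rule moment_cong) (use ja in auto)
  next
    fix U assume U: "U \<in> Pow P"
    show "{a\<in>{1..2*k}. (\<lambda>a\<in>{1..2*k}. if a \<in> U then w else i a) a = w} = U"
      using U P wi by auto
    show "(\<lambda>a\<in>{1..2*k}. if a \<in> U then w else i a) \<in> ?J"
      using U P by (auto simp: S_def)
  qed
  finally show ?thesis by (simp add: c_def)
qed

text \<open>In \<open>moment_rotate\<close> with four positions, odd subsets contribute nothing and
  complementary subsets contribute equally. This leaves
  \<open>f {} = 1/4 * (2 * f {} + 2 * (f {a,b} + f {a,c} + f {a,d}))\<close>, which is solved for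
  \<open>f {}\<close>.\<close>

lemma moment_four_equal:
  assumes i: "in_range k i" and v: "v < N" and w: "w < N" and vw: "v \<noteq> w" and wi: "w \<notin> i ` {1..2*k}"
    and P: "{x\<in>{1..2*k}. i x = v} = {a,b,c,d}" and dist: "distinct [a,b,c,d]"
  shows "moment \<mu> k i = (\<Sum>y\<in>{b,c,d}. moment \<mu> k (\<lambda>x. if x \<in> {a,y} then w else i x))"
proof -
  define f where "f U = moment \<mu> k (\<lambda>x. if x \<in> U then w else i x)" for U
  let ?P = "{a,b,c,d}"
  have PI: "?P \<subseteq> {1..2*k}" using P by blast
  have ran: "in_range k (\<lambda>x. if x \<in> U then w else i x)" for U using i w by (auto simp: in_range_def)
  have odd: "f U = 0" if "U \<subseteq> ?P" "odd (card U)" for U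
  proof -
    have "{x\<in>{1..2*k}. (if x \<in> U then w else i x) = w} = U" using that(1) PI wi by auto
    then show ?thesis unfolding f_def using moment_odd_index[OF ran, of U w] that(2) by simp
  qed
  \<comment> \<open>Passing to the complement exchanges the labels \<open>v\<close> and
    \<open>w\<close> on the four positions; the coincidences stay the same.\<close>
  have swap: "f U = f (?P - U)" if "U \<subseteq> ?P" for U
    unfolding f_def
  proof (rule moment_same_kernel[OF ran ran])
    fix x y assume xy: "x \<in> {1..2*k}" "y \<in> {1..2*k}"
    have "x \<in> ?P \<longleftrightarrow> i x = v" "y \<in> ?P \<longleftrightarrow> i y = v" using P xy by blast+
    then have P_iff: "x \<in> ?P - U \<longleftrightarrow> i x = v \<and> x \<notin> U" "y \<in> ?P - U \<longleftrightarrow> i y = v \<and> y \<notin> U"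
      and U: "x \<in> U \<Longrightarrow> i x = v" "y \<in> U \<Longrightarrow> i y = v" using that by blast+
    have w: "i x \<noteq> w" "i y \<noteq> w" using wi xy by blast+
    show "((if x \<in> U then w else i x) = (if y \<in> U then w else i y)) =
        ((if x \<in> ?P - U then w else i x) = (if y \<in> ?P - U then w else i y))"
      unfolding P_iff using U w vw by (cases "x \<in> U"; cases "y \<in> U") auto
  qed
  have "(1 / sqrt 2 :: real) ^ card ?P = 1 / 4"
    using dist by (simp add: power_divide eval_nat_numeral)
  then have "f {} = 1 / 4 * (\<Sum>U\<in>Pow ?P. f U)"
    using moment_rotate[OF i v w vw wi P[symmetric]] by (simp add: f_def)
  also have "(\<Sum>U\<in>Pow ?P. f U) = f {} + f {a,b} + f {a,c} + f {a,d} + f {b,c} + f {b,d} + f {c,d} + f {a,b,c,d}"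
    using dist by (simp add: sum_Pow_insert odd)
  finally have "f {} = 1 / 4 * \<dots>" .
  moreover have "f {b,c} = f {a,d}" "f {b,d} = f {a,c}" "f {c,d} = f {a,b}" "f {a,b,c,d} = f {}"
    using dist by (subst swap; force intro: arg_cong[of _ _ f])+
  ultimately have "f {} = f {a,b} + f {a,c} + f {a,d}" by simp
  then show ?thesis using dist by (simp add: f_def)
qed

lemma matches_in_range: "matches N k i m \<Longrightarrow> in_range k i"
  by (simp add: matches_def in_range_def)

text \<open>All index functions matching \<open>m\<close> have the same kernel, so any of them may
  replace the one chosen by \<open>index_fun\<close>.\<close>

lemma WgA_eq_moment_matches:
  assumes m: "m \<in> pair_partitions k" and N: "k \<le> N" and i: "matches N k i m"
  shows "WgA \<mu> N k m = moment \<mu> k i"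
  unfolding WgA_eq_moment
proof (rule moment_same_kernel)
  have j: "matches N k (index_fun N k m) m" using matches_index_fun[OF m N] .
  show "in_range k (index_fun N k m)" "in_range k i" using i j matches_in_range by auto
  fix a b assume "a \<in> {1..2*k}" "b \<in> {1..2*k}"
  then show "index_fun N k m a = index_fun N k m b \<longleftrightarrow> i a = i b"
    using i j unfolding matches_def by (cases "a = b") blast+
qed

text \<open>The block \<open>{p,c}\<close> is relabelled by \<open>j\<close>. If no other block has
  label \<open>j\<close>, the coincidences are unchanged. Otherwise four positions share
  \<open>j\<close>: of their three pairings one is that of \<open>m\<close>, and the other two arise
  by transposing \<open>p\<close> with a member of the block that was hit.\<close>

lemma moment_coincidence:
  assumes m: "m \<in> pair_partitions k" and i: "matches N k i m"
    and p: "p \<in> {1..2*k}" and c: "c \<in> {1..2*k}" "c \<noteq> p" "{p,c} \<in> m" and j: "j < N"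
  shows "moment \<mu> k (i(c := j, p := j)) =
    moment \<mu> k i + (\<Sum>b\<in>{b\<in>{1..2*k} - {c,p}. i b = j}. moment \<mu> k (i \<circ> Transposition.transpose b p))"
proof -
  let ?I = "{1..2*k}" and ?i = "i(c := j, p := j)"
  have ri: "in_range k i" using matches_in_range[OF i] .
  have rj: "in_range k ?i" using ri j by (auto simp: in_range_def)
  have eq_iff: "i x = i y \<longleftrightarrow> x = y \<or> {x,y} \<in> m" if "x \<in> ?I" "y \<in> ?I" for x y
    using i that unfolding matches_def by (cases "x = y") auto
  have partner_eq: "y = z" if "{x,y} \<in> m" "{x,z} \<in> m" for x y z
    using pair_partition_disjoint[OF m that, of x] by (auto simp: doubleton_eq_iff)
  have ip: "i x = i p \<longleftrightarrow> x \<in> {c,p}" if "x \<in> ?I" for x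
    using eq_iff[OF p that] c(3) partner_eq[OF c(3), of x] by auto
  have icp: "i c = i p" using ip c(1) by simp
  show ?thesis
  proof (cases "\<exists>b\<in>?I - {c,p}. i b = j")
    \<comment> \<open>The value \<open>j = i p\<close> also falls here, because only
      \<open>c\<close> and \<open>p\<close> carry that label.\<close>
    case False
    then have empty: "{b\<in>?I - {c,p}. i b = j} = {}" by blast
    have "moment \<mu> k ?i = moment \<mu> k i"
    proof (rule moment_same_kernel[OF rj ri])
      fix x y assume xy: "x \<in> ?I" "y \<in> ?I"
      have val: "?i x = (if i x = i p then j else i x)" and nj: "i x \<noteq> i p \<Longrightarrow> i x \<noteq> j" if "x \<in> ?I" for x
        using ip[OF that] False that by auto
      show "?i x = ?i y \<longleftrightarrow> i x = i y"
        unfolding val[OF xy(1)] val[OF xy(2)] using nj[OF xy(1)] nj[OF xy(2)] by auto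
    qed
    then show ?thesis unfolding empty by simp
  next
    case True
    then obtain b where b: "b \<in> ?I" "b \<notin> {c,p}" "i b = j" by blast
    obtain d where d: "d \<in> ?I" "d \<noteq> b" "{b,d} \<in> m" using pair_partition_partner[OF m b(1)] by blast
    have ib: "i x = j \<longleftrightarrow> x \<in> {b,d}" if "x \<in> ?I" for x
      using eq_iff[OF b(1) that] d(3) partner_eq[OF d(3), of x] b(3) by auto
    have dcp: "d \<notin> {c,p}" using ip[OF d(1)] ip[OF b(1)] ib[OF d(1)] b by auto
    have set: "{x\<in>?I. ?i x = j} = {c,p,b,d}" using ib p c b(1) d(1) by auto
    have set': "{x\<in>?I - {c,p}. i x = j} = {b,d}" using ib b(1,2) d(1) dcp by auto
    have jp: "j \<noteq> i p" using ip[OF b(1)] b by auto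
    \<comment> \<open>The old label \<open>i p\<close> became free when \<open>{p,c}\<close> was
      relabelled, so it serves as the fresh index \<open>w\<close>. Putting \<open>c\<close> first
      makes the summand \<open>y = p\<close> restore \<open>i\<close>.\<close>
    have "moment \<mu> k ?i = (\<Sum>y\<in>{p,b,d}. moment \<mu> k (\<lambda>x. if x \<in> {c,y} then i p else ?i x))"
    proof (rule moment_four_equal[OF rj j _ jp _ set])
      show "i p < N" using ri p by (auto simp: in_range_def)
      show "i p \<notin> ?i ` ?I"
      proof
        assume "i p \<in> ?i ` ?I"
        then obtain x where "x \<in> ?I" "i p = ?i x" by blast
        then show False using ip[of x] jp by (auto split: if_splits)
      qed
      show "distinct [c,p,b,d]" using c(2) b(2) d(2) dcp by auto
    qed
    also have "\<dots> = moment \<mu> k (\<lambda>x. if x \<in> {c,p} then i p else ?i x) +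
        (\<Sum>y\<in>{b,d}. moment \<mu> k (\<lambda>x. if x \<in> {c,y} then i p else ?i x))"
      using b(2) dcp by (subst sum.insert) auto
    also have "(\<lambda>x. if x \<in> {c,p} then i p else ?i x) = i" using icp by auto
    also have "(\<Sum>y\<in>{b,d}. moment \<mu> k (\<lambda>x. if x \<in> {c,y} then i p else ?i x)) =
        (\<Sum>y\<in>{b,d}. moment \<mu> k (i \<circ> Transposition.transpose y p))"
    proof (rule sum.cong[OF refl])
      fix y assume y: "y \<in> {b,d}"
      have iy: "i y = j" using y ib b(1) d(1) by blast
      have yc: "y \<noteq> c" and yp: "y \<noteq> p" using y b(2) dcp by auto
      have "(\<lambda>x. if x \<in> {c,y} then i p else ?i x) = i \<circ> Transposition.transpose y p"
      proof (rule ext)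
        fix x
        consider "x = c" | "x = y" | "x = p" | "x \<notin> {c,y,p}" by blast
        then show "(if x \<in> {c,y} then i p else ?i x) = (i \<circ> Transposition.transpose y p) x"
          by cases (use iy yc yp icp c(2) in \<open>simp_all add: Transposition.transpose_def\<close>)
      qed
      then show "moment \<mu> k (\<lambda>x. if x \<in> {c,y} then i p else ?i x) = moment \<mu> k (i \<circ> Transposition.transpose y p)"
        by simp
    qed
    finally show ?thesis unfolding set' .
  qed
qed

text \<open>Each position \<open>b\<close> outside the block \<open>{c,p}\<close> is hit for exactly
  one \<open>j\<close>, namely \<open>j = i b\<close>, so the collision terms regroup into one sum
  over \<open>b\<close>.\<close>

lemma sum_moment_coincidence:
  assumes m: "m \<in> pair_partitions k" and i: "matches N k i m"
    and p: "p \<in> {1..2*k}" and c: "c \<in> {1..2*k}" "c \<noteq> p" "{p,c} \<in> m"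
  shows "(\<Sum>j<N. moment \<mu> k (i(c := j, p := j))) =
    real N * moment \<mu> k i + (\<Sum>b\<in>{1..2*k} - {c,p}. moment \<mu> k (i \<circ> Transposition.transpose b p))"
proof -
  let ?D = "{1..2*k} - {c,p}"
  have "(\<Sum>j<N. moment \<mu> k (i(c := j, p := j))) = (\<Sum>j<N. moment \<mu> k i +
      (\<Sum>b\<in>{b\<in>?D. i b = j}. moment \<mu> k (i \<circ> Transposition.transpose b p)))"
    by (rule sum.cong) (use moment_coincidence[OF m i p c] in auto)
  also have "\<dots> = real N * moment \<mu> k i +
      (\<Sum>j<N. \<Sum>b\<in>{b\<in>?D. i b = j}. moment \<mu> k (i \<circ> Transposition.transpose b p))"
    by (simp add: sum.distrib)
  also have "(\<Sum>j<N. \<Sum>b\<in>{b\<in>?D. i b = j}. moment \<mu> k (i \<circ> Transposition.transpose b p)) =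
      (\<Sum>b\<in>?D. moment \<mu> k (i \<circ> Transposition.transpose b p))"
    using i by (intro sum.group) (auto simp: matches_def)
  finally show ?thesis .
qed

text \<open>The transposition only exchanges the two indices of the last factor, and the matrices
  are almost surely symmetric.\<close>

lemma moment_swap_last:
  assumes i: "in_range (Suc k) i"
  shows "moment \<mu> (Suc k) (i \<circ> Transposition.transpose (2*k+2) (2*k+1)) = moment \<mu> (Suc k) i"
proof -
  let ?j = "i \<circ> Transposition.transpose (2*k+2) (2*k+1)"
  have r: "i (2*k+1) < N" "i (2*k+2) < N" using in_rangeD[OF i, of k] by auto
  have j: "in_range (Suc k) ?j" using i by (auto simp: in_range_def Transposition.transpose_def)
  show ?thesis unfolding moment_def
  proof (rule integral_cong_AE)
    show "AE A in \<mu>. (\<Prod>s<Suc k. A (?j (2 * s + 1), ?j (2 * s + 2))) = (\<Prod>s<Suc k. A (i (2 * s + 1), i (2 * s + 2)))"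
      using AE_Aspace
    proof eventually_elim
      case (elim A)
      have "(\<Prod>s<k. A (?j (2 * s + 1), ?j (2 * s + 2))) = (\<Prod>s<k. A (i (2 * s + 1), i (2 * s + 2)))"
        by (rule prod.cong) (auto simp: Transposition.transpose_def)
      then show ?case using Aspace_sym[OF elim r] by (simp add: Transposition.transpose_def)
    qed
  qed (use integrable_monomial[OF i] integrable_monomial[OF j] in \<open>simp_all only: borel_measurable_integrable\<close>)
qed

section \<open>From trace and idempotency to the recursion\<close>

lemma sum_moment_eq:
  assumes "\<And>j. j < N \<Longrightarrow> in_range k (f j)" and "in_range l g"
    and "\<And>A. A \<in> Aspace M N \<Longrightarrow> (\<Sum>j<N. \<Prod>s<k. A (f j (2 * s + 1), f j (2 * s + 2))) =
      c * (\<Prod>s<l. A (g (2 * s + 1), g (2 * s + 2)))"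
  shows "(\<Sum>j<N. moment \<mu> k (f j)) = c * moment \<mu> l g"
proof -
  have int: "integrable \<mu> (\<lambda>A. \<Prod>s<k. A (f j (2 * s + 1), f j (2 * s + 2)))" if "j \<in> {..<N}" for j
    using assms(1) that by (intro integrable_monomial) auto
  have "(\<Sum>j<N. moment \<mu> k (f j)) = (\<integral>A. (\<Sum>j<N. \<Prod>s<k. A (f j (2 * s + 1), f j (2 * s + 2))) \<partial>\<mu>)"
    unfolding moment_def by (rule Bochner_Integration.integral_sum[symmetric, OF int])
  also have "\<dots> = (\<integral>A. c * (\<Prod>s<l. A (g (2 * s + 1), g (2 * s + 2))) \<partial>\<mu>)"
  proof (rule integral_cong_AE)
    show "AE A in \<mu>. (\<Sum>j<N. \<Prod>s<k. A (f j (2 * s + 1), f j (2 * s + 2))) = c * (\<Prod>s<l. A (g (2 * s + 1), g (2 * s + 2)))"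
      using AE_Aspace by eventually_elim (rule assms(3))
    show "(\<lambda>A. \<Sum>j<N. \<Prod>s<k. A (f j (2 * s + 1), f j (2 * s + 2))) \<in> borel_measurable \<mu>"
      by (intro borel_measurable_sum borel_measurable_integrable int)
    show "(\<lambda>A. c * (\<Prod>s<l. A (g (2 * s + 1), g (2 * s + 2)))) \<in> borel_measurable \<mu>"
      by (intro borel_measurable_times borel_measurable_const borel_measurable_integrable integrable_monomial assms(2))
  qed
  also have "\<dots> = c * moment \<mu> l g" by (simp add: moment_def)
  finally show ?thesis .
qed

text \<open>The last factor becomes \<open>A (j,j)\<close>, and the other factors do not involve
  \<open>j\<close>.\<close>

lemma sum_moment_trace:
  assumes i: "in_range (Suc k) i"
  shows "(\<Sum>j<N. moment \<mu> (Suc k) (i(2*k+2 := j, 2*k+1 := j))) = real M * moment \<mu> k i"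
proof (rule sum_moment_eq)
  show "in_range (Suc k) (i(2*k+2 := j, 2*k+1 := j))" if "j < N" for j using i that by (auto simp: in_range_def)
  show "in_range k i" using i by (rule in_range_Suc)
  fix A assume A: "A \<in> Aspace M N"
  let ?f = "\<lambda>j. i(2*k+2 := j, 2*k+1 := j)"
  have "(\<Prod>s<k. A (?f j (2 * s + 1), ?f j (2 * s + 2))) = (\<Prod>s<k. A (i (2 * s + 1), i (2 * s + 2)))" for j
    by (rule prod.cong) auto
  then have "(\<Sum>j<N. \<Prod>s<Suc k. A (?f j (2 * s + 1), ?f j (2 * s + 2))) =
      (\<Sum>j<N. (\<Prod>s<k. A (i (2 * s + 1), i (2 * s + 2))) * A (j,j))"
    by simp
  also have "\<dots> = real M * (\<Prod>s<k. A (i (2 * s + 1), i (2 * s + 2)))"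
    unfolding sum_distrib_left[symmetric] Aspace_trace[OF A] by (rule mult.commute)
  finally show "(\<Sum>j<N. \<Prod>s<Suc k. A (?f j (2 * s + 1), ?f j (2 * s + 2))) =
      real M * (\<Prod>s<k. A (i (2 * s + 1), i (2 * s + 2)))" .
qed

text \<open>The factor containing position \<open>c\<close> and the last factor share the index
  \<open>j\<close>. Summing over \<open>j\<close> contracts them by \<open>A\<^sup>2 = A\<close>,
  and the other index of the last factor moves to position \<open>c\<close>.\<close>

lemma sum_moment_idem:
  assumes i: "in_range (Suc k) i" and c: "c \<in> {1..2*k}"
  shows "(\<Sum>j<N. moment \<mu> (Suc k) (i(c := j, 2*k+1 := j))) = moment \<mu> k (i(c := i (2*k+2)))"
proof -
  let ?f = "\<lambda>j. i(c := j, 2*k+1 := j)" and ?g = "i(c := i (2*k+2))"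
  have "(\<Sum>j<N. moment \<mu> (Suc k) (?f j)) = 1 * moment \<mu> k ?g"
  proof (rule sum_moment_eq)
    show "in_range (Suc k) (?f j)" if "j < N" for j using i that by (auto simp: in_range_def)
    show g: "in_range k ?g" using i by (auto simp: in_range_def)
    fix A assume A: "A \<in> Aspace M N"
    define s\<^sub>0 where "s\<^sub>0 = (c-1) div 2"
    have s0: "s\<^sub>0 \<in> {..<k}" and c_cases: "c = 2 * s\<^sub>0 + 1 \<or> c = 2 * s\<^sub>0 + 2" using c by (auto simp: s\<^sub>0_def)
    let ?R = "\<Prod>s\<in>{..<k} - {s\<^sub>0}. A (i (2 * s + 1), i (2 * s + 2))"
    \<comment> \<open>\<open>s\<^sub>0\<close> numbers the factor containing position
      \<open>c\<close>; all other factors agree for \<open>h\<close> and \<open>i\<close>.\<close>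
    have split: "(\<Prod>s<k. A (h (2 * s + 1), h (2 * s + 2))) = A (h (2 * s\<^sub>0 + 1), h (2 * s\<^sub>0 + 2)) * ?R"
      if "\<And>x. x \<in> {1..2*k} \<Longrightarrow> x \<noteq> c \<Longrightarrow> h x = i x" for h :: "nat \<Rightarrow> nat"
    proof -
      have "(\<Prod>s\<in>{..<k} - {s\<^sub>0}. A (h (2 * s + 1), h (2 * s + 2))) = ?R"
      proof (rule prod.cong[OF refl])
        fix s assume "s \<in> {..<k} - {s\<^sub>0}"
        then have "2 * s + 1 \<in> {1..2*k}" "2 * s + 2 \<in> {1..2*k}" "2 * s + 1 \<noteq> c" "2 * s + 2 \<noteq> c"
          using c_cases by (auto; presburger)+
        then show "A (h (2 * s + 1), h (2 * s + 2)) = A (i (2 * s + 1), i (2 * s + 2))" using that by metis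
      qed
      then show ?thesis using prod.remove[OF _ s0, of "\<lambda>s. A (h (2 * s + 1), h (2 * s + 2))"] by simp
    qed
    have z: "i (2*k+2) < N" using in_rangeD[OF i, of k] by auto
    have r: "i (2 * s\<^sub>0 + 1) < N" "i (2 * s\<^sub>0 + 2) < N" using in_rangeD[OF i, of s\<^sub>0] s0 by auto
    have "(\<Sum>j<N. \<Prod>s<Suc k. A (?f j (2 * s + 1), ?f j (2 * s + 2))) =
        (\<Sum>j<N. A (?f j (2 * s\<^sub>0 + 1), ?f j (2 * s\<^sub>0 + 2)) * A (j, i (2*k+2))) * ?R"
    proof -
      have "(\<Prod>s<Suc k. A (?f j (2 * s + 1), ?f j (2 * s + 2))) =
          A (?f j (2 * s\<^sub>0 + 1), ?f j (2 * s\<^sub>0 + 2)) * A (j, i (2*k+2)) * ?R" for j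
      proof -
        have "?f j (2*k+1) = j" "?f j (2*k+2) = i (2*k+2)" using c by auto
        moreover have "(\<Prod>s<k. A (?f j (2 * s + 1), ?f j (2 * s + 2))) = A (?f j (2 * s\<^sub>0 + 1), ?f j (2 * s\<^sub>0 + 2)) * ?R"
          by (rule split) auto
        ultimately show ?thesis by (simp only: prod.lessThan_Suc mult_ac)
      qed
      then show ?thesis unfolding sum_distrib_right by (intro sum.cong refl)
    qed
    also have "(\<Sum>j<N. A (?f j (2 * s\<^sub>0 + 1), ?f j (2 * s\<^sub>0 + 2)) * A (j, i (2*k+2))) = A (?g (2 * s\<^sub>0 + 1), ?g (2 * s\<^sub>0 + 2))"
      using c_cases
    proof
      \<comment> \<open>Here \<open>j\<close> is the first index of both factors, so symmetry is
        needed to bring the sum into the form of a matrix product.\<close>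
      assume c': "c = 2 * s\<^sub>0 + 1"
      then have "(\<Sum>j<N. A (?f j (2 * s\<^sub>0 + 1), ?f j (2 * s\<^sub>0 + 2)) * A (j, i (2*k+2))) =
          (\<Sum>j<N. A (i (2*k+2), j) * A (j, i (2 * s\<^sub>0 + 2)))"
        using s0 Aspace_sym[OF A z] by (intro sum.cong) (auto simp: mult.commute)
      then show ?thesis using Aspace_idem[OF A z r(2)] c' by simp
    next
      assume c': "c = 2 * s\<^sub>0 + 2"
      then show ?thesis using Aspace_idem[OF A r(1) z] s0 by simp
    qed
    also have "A (?g (2 * s\<^sub>0 + 1), ?g (2 * s\<^sub>0 + 2)) * ?R = (\<Prod>s<k. A (?g (2 * s + 1), ?g (2 * s + 2)))"
      by (rule split[symmetric]) simp
    finally show "(\<Sum>j<N. \<Prod>s<Suc k. A (?f j (2 * s + 1), ?f j (2 * s + 2))) =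
        1 * (\<Prod>s<k. A (?g (2 * s + 1), ?g (2 * s + 2)))" by (simp only: mult_1)
  qed
  then show ?thesis by simp
qed

lemma matches_remove_last:
  assumes "matches N (Suc k) i m"
  shows "matches N k i (m - {last_pair k})"
  using assms unfolding matches_def by (auto simp: doubleton_eq_iff)

text \<open>Both sides evaluate the sum over \<open>j\<close> of the moments in which the block
  \<open>{2*k+1, c}\<close> is relabelled by \<open>j\<close>. The left side is
  \<open>sum_moment_coincidence\<close>; the right side comes from the trace if
  \<open>c = 2*k+2\<close> and from idempotency otherwise.\<close>

theorem WgA_recursion:
  assumes m: "m \<in> pair_partitions (Suc k)" and N: "Suc k \<le> N"
  shows "real N * WgA \<mu> N (Suc k) m + (\<Sum>a=1..2*k. WgA \<mu> N (Suc k) (odd_swap k a m)) =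
    real M * drop_last (WgA \<mu> N k) k m + (\<Sum>a=1..2*k. drop_last (WgA \<mu> N k) k (odd_swap k a m))"
proof -
  let ?p = "2*k+1" and ?I = "{1..2 * Suc k}"
  define i where "i = index_fun N (Suc k) m"
  have i: "matches N (Suc k) i m" unfolding i_def by (rule matches_index_fun[OF m N])
  note ri = matches_in_range[OF i]
  have pI: "?p \<in> ?I" by simp
  have eq_iff: "i x = i y \<longleftrightarrow> x = y \<or> {x,y} \<in> m" if "x \<in> ?I" "y \<in> ?I" for x y
    using i that unfolding matches_def by (cases "x = y") auto
  obtain c where c: "c \<in> ?I" "c \<noteq> ?p" "{?p,c} \<in> m" "\<And>z. {?p,z} \<in> m \<longleftrightarrow> z = c"
    using pair_partition_partner[OF m pI] by blast
  have icp: "i c = i ?p" using eq_iff[OF pI c(1)] c(3) by simp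
  have W: "WgA \<mu> N (Suc k) m = moment \<mu> (Suc k) i" by (rule WgA_eq_moment_matches[OF m N i])
  have swap_pp: "odd_swap k a m \<in> pair_partitions (Suc k)" if "a \<in> {1..2*k}" for a
    by (rule transpose_pair_partition[OF m _ pI]) (use that in auto)
  have swap_matches: "matches N (Suc k) (i \<circ> Transposition.transpose a ?p) (odd_swap k a m)" if "a \<in> {1..2*k}" for a
    by (rule matches_transpose[OF i _ pI]) (use that in auto)
  have Wswap: "WgA \<mu> N (Suc k) (odd_swap k a m) = moment \<mu> (Suc k) (i \<circ> Transposition.transpose a ?p)"
    if "a \<in> {1..2*k}" for a
    by (rule WgA_eq_moment_matches[OF swap_pp[OF that] N swap_matches[OF that]])
  have last_swap: "last_pair k \<in> odd_swap k a m \<longleftrightarrow> {2*k+2, a} \<in> m" if "a \<in> {1..2*k}" for a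
    unfolding pair_in_transpose_iff using that by (simp add: Transposition.transpose_def insert_commute)
  note S = sum_moment_coincidence[OF m i pI c(1,2,3)]
  show ?thesis
  proof (cases "last_pair k \<in> m")
    \<comment> \<open>The partner of \<open>2*k+2\<close> is \<open>2*k+1\<close>, so no
      \<open>odd_swap k a m\<close> contains the last pair and only the term with \<open>M\<close>
      survives on the right.\<close>
    case True
    then have c_eq: "c = 2*k+2" using c(4)[of "2*k+2"] by simp
    have "{2*k+2, a} \<notin> m" if "a \<in> {1..2*k}" for a
    proof
      assume "{2*k+2, a} \<in> m"
      from pair_partition_disjoint[OF m this True, of "2*k+2"] show False using that by (auto simp: doubleton_eq_iff)
    qed
    then have "(\<Sum>a=1..2*k. drop_last (WgA \<mu> N k) k (odd_swap k a m)) = 0"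
      using last_swap by (intro sum.neutral) (simp add: drop_last_def)
    moreover have "drop_last (WgA \<mu> N k) k m = moment \<mu> k i"
      using True WgA_eq_moment_matches[OF pair_partition_remove_last[OF m True] _ matches_remove_last[OF i]] N
      by (simp add: drop_last_def)
    moreover have "?I - {c,?p} = {1..2*k}" unfolding c_eq by auto
    ultimately show ?thesis
      using S Wswap W sum_moment_trace[OF ri] unfolding c_eq by simp
  next
    case False
    have ck: "c \<in> {1..2*k}"
    proof -
      have "c \<noteq> 2*k+2" using False c(3) by auto
      then show ?thesis using c(1,2) by auto
    qed
    have zI: "2*k+2 \<in> ?I" by simp
    obtain a where a: "a \<in> ?I" "a \<noteq> 2*k+2" "{2*k+2,a} \<in> m" "\<And>z. {2*k+2,z} \<in> m \<longleftrightarrow> z = a"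
      using pair_partition_partner[OF m zI] by blast
    have "a \<noteq> ?p" using False a(3) by (auto simp: insert_commute)
    then have ak: "a \<in> {1..2*k}" using a(1,2) by auto
    have iaz: "i (2*k+2) = i a" using eq_iff[OF zI a(1)] a(3) by simp
    have ip: "i x = i ?p \<longleftrightarrow> x = c" and ia: "i x = i a \<longleftrightarrow> x = a" if "x \<in> {1..2*k}" for x
    proof -
      have xI: "x \<in> ?I" using that by auto
      show "i x = i ?p \<longleftrightarrow> x = c" using eq_iff[OF pI xI] c(4)[of x] that by auto
      show "i x = i a \<longleftrightarrow> x = a" using eq_iff[OF zI xI] a(4)[of x] that iaz by auto
    qed
    \<comment> \<open>The range has \<open>b = 2*k+2\<close> in addition and \<open>b = c\<close>
      missing. Both transpositions give the moment of \<open>i\<close>, the first by symmetry of the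
      matrices and the second because \<open>c\<close> and \<open>2*k+1\<close> share a label, so
      the sum equals the one over \<open>{1..2*k}\<close>.\<close>
    have "(\<Sum>b\<in>?I - {c,?p}. moment \<mu> (Suc k) (i \<circ> Transposition.transpose b ?p)) =
        (\<Sum>b\<in>insert (2*k+2) ({1..2*k} - {c}). moment \<mu> (Suc k) (i \<circ> Transposition.transpose b ?p))"
      using ck by (intro sum.cong) auto
    also have "\<dots> = moment \<mu> (Suc k) i +
        (\<Sum>b\<in>{1..2*k} - {c}. moment \<mu> (Suc k) (i \<circ> Transposition.transpose b ?p))"
      using moment_swap_last[OF ri] by (subst sum.insert) auto
    also have "\<dots> = (\<Sum>b=1..2*k. moment \<mu> (Suc k) (i \<circ> Transposition.transpose b ?p))"
    proof -
      have "i \<circ> Transposition.transpose c ?p = i" using icp by (auto simp: fun_eq_iff Transposition.transpose_def)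
      then show ?thesis using ck by (subst (2) sum.remove[of _ c]) auto
    qed
    finally have L: "real N * WgA \<mu> N (Suc k) m + (\<Sum>a=1..2*k. WgA \<mu> N (Suc k) (odd_swap k a m)) =
        moment \<mu> k (i(c := i (2*k+2)))"
      using S Wswap W sum_moment_idem[OF ri ck] by simp
    \<comment> \<open>Only the partner \<open>a\<close> of \<open>2*k+2\<close> produces the last
      pair.\<close>
    have "(\<Sum>b=1..2*k. drop_last (WgA \<mu> N k) k (odd_swap k b m)) =
        (\<Sum>b=1..2*k. if b = a then drop_last (WgA \<mu> N k) k (odd_swap k a m) else 0)"
      using last_swap a(4) by (intro sum.cong) (auto simp: drop_last_def)
    also have "\<dots> = drop_last (WgA \<mu> N k) k (odd_swap k a m)" using ak by simp
    also have "\<dots> = moment \<mu> k (i \<circ> Transposition.transpose a ?p)"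
    proof -
      have E: "last_pair k \<in> odd_swap k a m" using last_swap[OF ak] a(3) by blast
      then show ?thesis
        using WgA_eq_moment_matches[OF pair_partition_remove_last[OF swap_pp[OF ak] E] _
            matches_remove_last[OF swap_matches[OF ak]]] N
        by (simp add: drop_last_def)
    qed
    \<comment> \<open>Both index functions join \<open>a\<close> and \<open>c\<close> into one
      block: the first gives \<open>a\<close> the label of \<open>c\<close>, the second gives
      \<open>c\<close> the label of \<open>a\<close>.\<close>
    also have "\<dots> = moment \<mu> k (i(c := i (2*k+2)))"
    proof (rule moment_same_kernel)
      show "in_range k (i \<circ> Transposition.transpose a ?p)"
        by (rule in_range_Suc[OF matches_in_range[OF swap_matches[OF ak]]])
      show "in_range k (i(c := i (2*k+2)))" using ri by (auto simp: in_range_def)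
      fix x y assume xy: "x \<in> {1..2*k}" "y \<in> {1..2*k}"
      have t: "(i \<circ> Transposition.transpose a ?p) x = (if x = a then i ?p else i x)" if "x \<in> {1..2*k}" for x
        using that by (auto simp: Transposition.transpose_def)
      show "(i \<circ> Transposition.transpose a ?p) x = (i \<circ> Transposition.transpose a ?p) y \<longleftrightarrow>
          (i(c := i (2*k+2))) x = (i(c := i (2*k+2))) y"
        unfolding t[OF xy(1)] t[OF xy(2)] iaz fun_upd_def
        using ip[OF xy(1)] ip[OF xy(2)] ia[OF xy(1)] ia[OF xy(2)] ip[OF ak] ia[OF ck] icp
        by (cases "x = a"; cases "y = a"; cases "x = c"; cases "y = c") simp_all
    qed
    finally show ?thesis using L False by (simp add: drop_last_def)
  qed
qed

lemma WgA_bound: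
  assumes "m \<in> pair_partitions k" "k \<le> N"
  shows "\<bar>WgA \<mu> N k m\<bar> \<le> 1"
  unfolding WgA_eq_moment
  by (rule moment_bound[OF matches_in_range[OF matches_index_fun[OF assms]]])

lemma WgA_0: "WgA \<mu> N 0 m = 1"
  by (simp add: WgA_eq_moment moment_def prob_space)

end

section \<open>Asymptotic expansion\<close>

text \<open>The first \<open>R\<close> terms, with \<open>l\<close> for \<open>M/N\<close> and
  \<open>x\<close> for \<open>-1/N\<close>. Then \<open>t = 1 - 1/l\<close>, and the prefactor
  \<open>l ^ k\<close> is the inverse of \<open>(1-t)^k\<close>.\<close>

definition partial_expansion :: "real \<Rightarrow> real \<Rightarrow> nat \<Rightarrow> nat \<Rightarrow> nat set set \<Rightarrow> real" where
  "partial_expansion l x R k m = l ^ k * (\<Sum>r<R. hsum (1 - 1 / l) k m r * x ^ r)"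

lemma drop_last_partial_expansion:
  "drop_last (partial_expansion l x R k) k m =
    l ^ k * (\<Sum>r<R. drop_last (\<lambda>m. hsum (1 - 1 / l) k m r) k m * x ^ r)"
  by (simp add: drop_last_def partial_expansion_def)

text \<open>This is \<open>WgA_recursion\<close> divided by \<open>N\<close>, for truncations: the
  terms carrying a factor \<open>x\<close> appear with one order less. The correction
  \<open>t - 1\<close> of \<open>hsum_Suc\<close> equals \<open>-1/l\<close>, so one factor
  \<open>l\<close> of the prefactor turns it into \<open>-1\<close>.\<close>

lemma partial_expansion_Suc:
  assumes "l \<noteq> 0"
  shows "partial_expansion l x (Suc R) (Suc k) m = l * drop_last (partial_expansion l x (Suc R) k) k m +
    x * (\<Sum>a=1..2*k. partial_expansion l x R (Suc k) (odd_swap k a m) -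
      drop_last (partial_expansion l x R k) k (odd_swap k a m))"
proof -
  let ?t = "1 - 1 / l"
  let ?h = "\<lambda>m r. hsum ?t (Suc k) m r" and ?d = "\<lambda>m r. drop_last (\<lambda>m. hsum ?t k m r) k m"
  have "partial_expansion l x (Suc R) (Suc k) m =
      l ^ Suc k * (?h m 0 + (\<Sum>r<R. ?h m (Suc r) * x ^ Suc r))"
    unfolding partial_expansion_def sum.lessThan_Suc_shift by simp
  also have "(\<Sum>r<R. ?h m (Suc r) * x ^ Suc r) = (\<Sum>r<R. ?d m (Suc r) * x ^ Suc r) +
      (\<Sum>r<R. (\<Sum>a=1..2*k. ?h (odd_swap k a m) r + (?t - 1) * ?d (odd_swap k a m) r) * x ^ Suc r)"
    unfolding hsum_Suc distrib_right sum.distrib ..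
  also have "(\<Sum>r<R. (\<Sum>a=1..2*k. ?h (odd_swap k a m) r + (?t - 1) * ?d (odd_swap k a m) r) * x ^ Suc r) =
      x * (\<Sum>a=1..2*k. \<Sum>r<R. ?h (odd_swap k a m) r * x ^ r + (?t - 1) * (?d (odd_swap k a m) r * x ^ r))"
    unfolding sum_distrib_left sum_distrib_right
    by (subst sum.swap) (simp add: algebra_simps)
  also have "l ^ Suc k * (?h m 0 + ((\<Sum>r<R. ?d m (Suc r) * x ^ Suc r) + x * (\<Sum>a=1..2*k. \<Sum>r<R.
        ?h (odd_swap k a m) r * x ^ r + (?t - 1) * (?d (odd_swap k a m) r * x ^ r)))) =
      l * (l ^ k * (\<Sum>r<Suc R. ?d m r * x ^ r)) + x * (\<Sum>a=1..2*k. l ^ Suc k * (\<Sum>r<R. ?h (odd_swap k a m) r * x ^ r)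
        + (l * (?t - 1)) * (l ^ k * (\<Sum>r<R. ?d (odd_swap k a m) r * x ^ r)))"
    unfolding hsum_0 sum.lessThan_Suc_shift sum.distrib sum_distrib_left[symmetric]
    by (simp add: algebra_simps)
  also have "l * (?t - 1) = -1" using assms by (simp add: field_simps)
  finally show ?thesis unfolding drop_last_partial_expansion partial_expansion_def by simp
qed

lemma drop_last_diff: "drop_last (\<lambda>m. f m - g m) k m = drop_last f k m - drop_last g k m"
  by (simp add: drop_last_def)

text \<open>The error \<open>D\<close> obeys the common recursion of the Weingarten function and its
  truncations. Induction on \<open>k\<close> controls the \<open>drop_last\<close> terms to every
  order; an inner induction on \<open>R\<close> controls the terms at level \<open>Suc k\<close>,
  which carry a factor \<open>-1/N\<close>.\<close>

theorem WgA_expansion: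
  fixes p q :: nat and \<mu> :: "nat \<Rightarrow> rmat measure"
  assumes p: "0 < p" and q: "0 < q" and haar: "\<And>n. n \<ge> 1 \<Longrightarrow> haar_A (p*n) (q*n) (\<mu> n)"
    and m: "m \<in> pair_partitions k"
  shows "(\<lambda>n. WgA (\<mu> n) (q*n) k m - partial_expansion (real p / real q) (- 1 / real (q*n)) R k m)
    \<in> O(\<lambda>n. (1 / real n) ^ R)"
proof -
  define l where "l = real p / real q"
  have l0: "l \<noteq> 0" using p q by (simp add: l_def)
  define D where "D k R m n = WgA (\<mu> n) (q*n) k m - partial_expansion l (- 1 / real (q*n)) R k m" for k R m n
  have proj: "haar_projection (p*n) (q*n) (\<mu> n)" if "n \<ge> 1" for n
    using haar[OF that] by unfold_locales
  have "D k R m \<in> O(\<lambda>n. (1 / real n) ^ R)" if "m \<in> pair_partitions k" for k R m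
    using that
  proof (induction k arbitrary: R m)
    \<comment> \<open>The Weingarten function is 1 and equals the term \<open>r = 0\<close>; for
      \<open>R = 0\<close> the truncation is empty and the constant error 1 is
      \<open>O(1)\<close>.\<close>
    case 0
    then have m: "m = {}" by (simp add: pair_partitions_0)
    have D: "eventually (\<lambda>n. D 0 R m n = (if R = 0 then 1 else 0)) at_top"
      using eventually_ge_at_top[of 1]
    proof eventually_elim
      case (elim n)
      interpret haar_projection "p*n" "q*n" "\<mu> n" using proj elim .
      show ?case unfolding D_def WgA_0
        by (simp add: partial_expansion_def m hsum_zero_points if_distrib[of "\<lambda>z. z * _"] cong: if_cong)
    qed
    show ?case by (subst landau_o.big.in_cong[OF D]) simp
  next
    case (Suc k)
    note IHk = Suc.IH
    have drop: "(\<lambda>n. drop_last (\<lambda>m. D k R m n) k m) \<in> O(\<lambda>n. (1 / real n) ^ R)"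
      if "m \<in> pair_partitions (Suc k)" for m R
    proof (cases "last_pair k \<in> m")
      case True
      then show ?thesis unfolding drop_last_def using IHk[OF pair_partition_remove_last[OF that True]]
        by (simp only: if_True)
    next
      case False
      then show ?thesis unfolding drop_last_def by (simp only: if_False zero_in_bigo)
    qed
    show ?case using Suc.prems
    proof (induction R arbitrary: m)
      \<comment> \<open>An empty truncation leaves the Weingarten function itself, which is bounded
        by 1.\<close>
      case 0
      have "eventually (\<lambda>n. norm (D (Suc k) 0 m n) \<le> 1 * norm ((1 / real n) ^ 0)) at_top"
        using eventually_ge_at_top[of "Suc k"]
      proof eventually_elim
        case (elim n)
        interpret haar_projection "p*n" "q*n" "\<mu> n" by (rule proj) (use elim in simp)
        have "n \<le> q * n" using q by simp
        then have "Suc k \<le> q * n" using elim by (rule order_trans[rotated])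
        then show ?case using WgA_bound[OF 0] by (simp add: D_def partial_expansion_def)
      qed
      then show ?case by (rule bigoI)
    next
      case (Suc R)
      have swap: "odd_swap k a m \<in> pair_partitions (Suc k)" if "a \<in> {1..2*k}" for a
        by (rule transpose_pair_partition[OF Suc.prems]) (use that in auto)
      let ?S = "\<lambda>n. \<Sum>a=1..2*k. D (Suc k) R (odd_swap k a m) n - drop_last (\<lambda>m. D k R m n) k (odd_swap k a m)"
      \<comment> \<open>The recursion needs \<open>Suc k \<le> q*n\<close>, so that index functions
        exist; this holds once \<open>n\<close> is at least \<open>Suc k\<close>.\<close>
      have rec: "eventually (\<lambda>n. D (Suc k) (Suc R) m n =
          l * drop_last (\<lambda>m. D k (Suc R) m n) k m + (- 1 / real (q*n)) * ?S n) at_top"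
        using eventually_ge_at_top[of "Suc k"]
      proof eventually_elim
        case (elim n)
        interpret haar_projection "p*n" "q*n" "\<mu> n" by (rule proj) (use elim in simp)
        have "n \<le> q * n" using q by simp
        then have N: "Suc k \<le> q * n" using elim by (rule order_trans[rotated])
        define x where "x = - 1 / real (q*n)"
        let ?W = "WgA (\<mu> n) (q*n)"
        have "?W (Suc k) m = l * drop_last (?W k) k m +
            x * ((\<Sum>a=1..2*k. ?W (Suc k) (odd_swap k a m)) - (\<Sum>a=1..2*k. drop_last (?W k) k (odd_swap k a m)))"
        proof -
          have "real (q*n) * ?W (Suc k) m = real (p*n) * drop_last (?W k) k m -
            ((\<Sum>a=1..2*k. ?W (Suc k) (odd_swap k a m)) - (\<Sum>a=1..2*k. drop_last (?W k) k (odd_swap k a m)))"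
            using WgA_recursion[OF Suc.prems N] by linarith
          moreover have "real (q*n) \<noteq> 0" using N by linarith
          moreover have "real (p*n) / real (q*n) = l" using elim by (simp add: l_def)
          ultimately show ?thesis unfolding x_def
            by (simp add: field_simps)
        qed
        then show ?case
          unfolding D_def drop_last_diff x_def[symmetric] using partial_expansion_Suc[OF l0, of x R k m]
          by (simp add: algebra_simps sum.distrib sum_subtractf)
      qed
      have "?S \<in> O(\<lambda>n. (1 / real n) ^ R)"
        using swap Suc.IH drop by (intro big_sum_in_bigo sum_in_bigo(2)) auto
      moreover have "(\<lambda>n. - 1 / real (q*n)) \<in> O(\<lambda>n. 1 / real n)"
        by (intro bigoI[of _ "1 / real q"] always_eventually) (simp add: field_simps)
      ultimately have "(\<lambda>n. (- 1 / real (q*n)) * ?S n) \<in> O(\<lambda>n. 1 / real n * (1 / real n) ^ R)"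
        by (intro landau_o.big.mult)
      moreover have "(\<lambda>n. l * drop_last (\<lambda>m. D k (Suc R) m n) k m) \<in> O(\<lambda>n. (1 / real n) ^ Suc R)"
        by (rule landau_o.big.cmult_in_iff[OF l0, THEN iffD2, OF drop[OF Suc.prems]])
      ultimately show ?case unfolding landau_o.big.in_cong[OF rec] power_Suc
        by (intro sum_in_bigo(1))
    qed
  qed
  from this[OF m, of R] show ?thesis unfolding D_def l_def .
qed

text \<open>The ratio \<open>M/N = p/q\<close> is fixed by \<open>M = p*n\<close> and
  \<open>N = q*n\<close>, and the series is read as an asymptotic expansion: truncation at any order
  \<open>R\<close> leaves an error \<open>O(n^(-R))\<close>. Since \<open>1 - t = q/p\<close>, the
  prefactor is \<open>(p/q)^k\<close>.\<close>

theorem mainTheorem4: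
  fixes p q k :: nat and m :: "nat set set" and \<mu> :: "nat \<Rightarrow> rmat measure"
  assumes "0 < p" and "p < q"
    and "m \<in> pair_partitions k"
    and "\<And>n. n \<ge> 1 \<Longrightarrow> haar_A (p*n) (q*n) (\<mu> n)"
  shows "\<forall>R::nat. (\<lambda>n. WgA (\<mu> n) (q*n) k m
            - (1 / (1 - (1 - real q / real p)) ^ k) *
              (\<Sum>r<R. poly (map_poly of_int (hvec k m r)) (1 - real q / real p)
                        * (- 1 / real (q*n)) ^ r))
         \<in> O(\<lambda>n. (1 / real n) ^ R)"
proof
  fix R :: nat
  have "1 / (1 - (1 - real q / real p)) ^ k = (real p / real q) ^ k"
    by (simp add: power_divide)
  moreover have "1 - real q / real p = 1 - 1 / (real p / real q)" by simp
  ultimately show "(\<lambda>n. WgA (\<mu> n) (q*n) k m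
            - (1 / (1 - (1 - real q / real p)) ^ k) *
              (\<Sum>r<R. poly (map_poly of_int (hvec k m r)) (1 - real q / real p)
                        * (- 1 / real (q*n)) ^ r))
         \<in> O(\<lambda>n. (1 / real n) ^ R)"
    using WgA_expansion[OF assms(1) _ assms(4,3), of R] assms(1,2)
    by (simp only: partial_expansion_def hsum_eq_poly)
qed

end
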